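(* Let $n\ge1$, $m\ge0$, $\alpha_\circ\in\mathbb R$, $\boldsymbol\alpha\in\mathbb R^n$, $\boldsymbol\beta\in\mathbb R^m$ with $\alpha_i+\alpha_\circ>0$, $\alpha_i+\alpha_j>0$ and $\alpha_i+\beta_k>0$ for all $1\le i,j\le n$, $1\le k\le m$. Let $\mathcal I=\{(i,j):1\le i\le n,\ i\le j\le 2n+m-i+1\}$ and let $(W_{i,j})_{(i,j)\in\mathcal I}$ be independent with $W_{i,j}\sim\mathrm{Gamma}^{-1}(\alpha_i+\alpha_\circ)$ if $i=j$; $\mathrm{Gamma}^{-1}(\alpha_i+\alpha_j)$ if $i<j\le n$; $\mathrm{Gamma}^{-1}(\alpha_i+\beta_{j-n})$ if $n<j\le n+m$; $\mathrm{Gamma}^{-1}(\alpha_i+\alpha_{2n+m-j+1})$ if $n+m<j\le 2n+m-i+1$. Let $Z^{\mathrm{trap}}(n;m)=\sum_{k=1}^n\sum_{\pi:(1,1)\to(k,2n-k+m+1)}\prod_{(i,j)\in\pi}W_{i,j}$ (inner sum over up-right paths in $\mathcal I$). Then for every $r>0$, $$\mathbb E\big[e^{-rZ^{\mathrm{trap}}(n;m)}\big]=\frac{r^{\sum_{k=1}^n\alpha_k}}{\prod_{i=1}^n\Gamma(\alpha_i+\alpha_\circ)\prod_{j=1}^n\Gamma(\alpha_i+\alpha_j)\prod_{k=1}^m\Gamma(\alpha_i+\beta_k)}\int_{\mathbb R_{>0}^n}\mathcal T_{\alpha_\circ,\boldsymbol\beta;r}(\boldsymbol x)\,\Psi^{\mathfrak{so}_{2n+1}}_{\boldsymbol\alpha}(\boldsymbol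 x)\prod_{i=1}^n\frac{dx_i}{x_i}.$$
   Context: $\mathrm{Gamma}^{-1}(\theta)$ is the inverse-gamma law with density $\frac1{\Gamma(\theta)}x^{-\theta-1}e^{-1/x}$, $x>0$. Up-right paths move by unit steps increasing one coordinate; products include all path points. $\mathcal T$: for $\boldsymbol x\in\mathbb R_{>0}^n$, with variables $t_{i,j}$ ($1\le i\le n$, $i\le j\le i+m-1$) and $t_{i,i+m}:=x_i$, $\mathcal T_{\alpha,\boldsymbol\beta;r}(\boldsymbol x)=\int_{\mathbb R_{>0}^{nm}}\big(\prod_{i=1}^n(rt_{i,i})^{(-1)^{n-i}}\big)^{\alpha}\prod_{j=1}^m\big(\prod_{i=1}^n\frac{t_{i,i+j}}{t_{i,i+j-1}}\big)^{\beta_j}\exp\big(-rt_{1,1}-\sum_{i=2}^n\sum_{j=i}^{i+m-1}\frac{t_{i,j}}{t_{i-1,j}}-\sum_{i=1}^n\sum_{j=i}^{i+m-1}\frac{t_{i,j+1}}{t_{i,j}}\big)\prod_{i,j}\frac{dt_{i,j}}{t_{i,j}}$; for $m=0$, $\mathcal T_{\alpha,\emptyset;r}(\boldsymbol x)=\big(\prod_{i}(rx_i)^{(-1)^{n-i}}\big)^{\alpha}e^{-rx_1}$. $\mathfrak{so}_{2n+1}$-Whittaker function: with an array $\boldsymbol z=(z_{i,j})_{1\le i\le 2n,\,1\le j\le\lceil i/2\rceil}$, $z_{2n,j}:=x_j$, and $z_{i,j}:=1$ if $j>\lceil i/2\rceil$; $\mathrm{type}(\boldsymbol z)_i=\prod_{j=1}^{\lceil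 i/2\rceil}z_{i,j}/\prod_{j=1}^{\lceil (i-1)/2\rceil}z_{i-1,j}$; $\boldsymbol\alpha^\pm=(\alpha_1,-\alpha_1,\dots,\alpha_n,-\alpha_n)$ and $\mathrm{type}(\boldsymbol z)^{\boldsymbol\alpha^\pm}=\prod_{i=1}^{2n}\mathrm{type}(\boldsymbol z)_i^{\alpha^\pm_i}$; $\Psi^{\mathfrak{so}_{2n+1}}_{\boldsymbol\alpha}(\boldsymbol x)=\int_{\mathbb R_{>0}^{n^2}}\mathrm{type}(\boldsymbol z)^{\boldsymbol\alpha^\pm}\exp\big(-\sum_{i=1}^{2n-1}\sum_{j=1}^{\lceil i/2\rceil}(\frac{z_{i+1,j+1}}{z_{i,j}}+\frac{z_{i,j}}{z_{i+1,j}})\big)\prod_{1\le i<2n,\,1\le j\le\lceil i/2\rceil}\frac{dz_{i,j}}{z_{i,j}}$. *)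

theory Defs
  imports "HOL-Probability.Probability"
begin

definition inv_gamma_measure :: "real \<Rightarrow> real measure" where
  "inv_gamma_measure \<theta> = density lborel
     (\<lambda>x. ennreal (if x > 0 then x powr (-\<theta> - 1) * exp (-1 / x) / Gamma \<theta> else 0))"

definition haar_pos :: "real measure" where
  "haar_pos = density lborel (\<lambda>t. ennreal (if t > 0 then 1 / t else 0))"

definition trap_index :: "nat \<Rightarrow> nat \<Rightarrow> (nat \<times> nat) set" where
  "trap_index n m = {(i, j). 1 \<le> i \<and> i \<le> n \<and> i \<le> j \<and> j \<le> 2 * n + m + 1 - i}"

definition trap_param :: "nat \<Rightarrow> nat \<Rightarrow> real \<Rightarrow> (nat \<Rightarrow> real) \<Rightarrow> (nat \<Rightarrow> real)
    \<Rightarrow> nat \<times> nat \<Rightarrow> real" where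
  "trap_param n m a0 a b q = (case q of (i, j) \<Rightarrow>
     if i = j then a i + a0
     else if j \<le> n then a i + a j
     else if j \<le> n + m then a i + b (j - n)
     else a i + a (2 * n + m + 1 - j))"

definition up_right_path :: "(nat \<times> nat) list \<Rightarrow> nat \<times> nat \<Rightarrow> nat \<times> nat \<Rightarrow> bool" where
  "up_right_path p s e \<longleftrightarrow> p \<noteq> [] \<and> hd p = s \<and> last p = e \<and>
     (\<forall>k < length p - 1. p ! (k + 1) = (fst (p ! k) + 1, snd (p ! k)) \<or>
                         p ! (k + 1) = (fst (p ! k), snd (p ! k) + 1))"

definition Z_trap :: "nat \<Rightarrow> nat \<Rightarrow> (nat \<times> nat \<Rightarrow> 'w \<Rightarrow> real) \<Rightarrow> 'w \<Rightarrow> real" where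
  "Z_trap n m W \<omega> = (\<Sum>k = 1..n. \<Sum>p \<in> {p. up_right_path p (1, 1) (k, 2 * n + m + 1 - k)
        \<and> set p \<subseteq> trap_index n m}. prod_list (map (\<lambda>q. W q \<omega>) p))"

definition T_vars :: "nat \<Rightarrow> nat \<Rightarrow> (nat \<times> nat) set" where
  "T_vars n m = {(i, j). 1 \<le> i \<and> i \<le> n \<and> i \<le> j \<and> j < i + m}"

definition T_ext :: "nat \<Rightarrow> (nat \<times> nat \<Rightarrow> real) \<Rightarrow> (nat \<Rightarrow> real) \<Rightarrow> nat \<Rightarrow> nat \<Rightarrow> real" where
  "T_ext m t x i j = (if j = i + m then x i else t (i, j))"

definition T_integrand :: "nat \<Rightarrow> nat \<Rightarrow> real \<Rightarrow> (nat \<Rightarrow> real) \<Rightarrow> real \<Rightarrow> (nat \<Rightarrow> real)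
    \<Rightarrow> (nat \<times> nat \<Rightarrow> real) \<Rightarrow> real" where
  "T_integrand n m a0 b r x t =
    (let tt = T_ext m t x in
      (\<Prod>i = 1..n. (r * tt i i) powr ((-1) ^ (n - i))) powr a0
      * (\<Prod>j = 1..m. \<Prod>i = 1..n. (tt i (i + j) / tt i (i + j - 1)) powr b j)
      * exp (- (r * tt 1 1)
             - (\<Sum>i = 2..n. \<Sum>j = i..i + m - 1. tt i j / tt (i - 1) j)
             - (\<Sum>i = 1..n. \<Sum>j = i..i + m - 1. tt i (j + 1) / tt i j)))"

definition T_fun :: "nat \<Rightarrow> nat \<Rightarrow> real \<Rightarrow> (nat \<Rightarrow> real) \<Rightarrow> real \<Rightarrow> (nat \<Rightarrow> real) \<Rightarrow> ennreal" where
  "T_fun n m a0 b r x =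
     (\<integral>\<^sup>+ t. ennreal (T_integrand n m a0 b r x t) \<partial>(PiM (T_vars n m) (\<lambda>_. haar_pos)))"

definition Psi_vars :: "nat \<Rightarrow> (nat \<times> nat) set" where
  "Psi_vars n = {(i, j). 1 \<le> i \<and> i < 2 * n \<and> 1 \<le> j \<and> j \<le> (i + 1) div 2}"

definition Psi_ext :: "nat \<Rightarrow> (nat \<times> nat \<Rightarrow> real) \<Rightarrow> (nat \<Rightarrow> real) \<Rightarrow> nat \<Rightarrow> nat \<Rightarrow> real" where
  "Psi_ext n z x i j = (if (i + 1) div 2 < j then 1 else if i = 2 * n then x j else z (i, j))"

definition so_type :: "(nat \<Rightarrow> nat \<Rightarrow> real) \<Rightarrow> nat \<Rightarrow> real" where
  "so_type zz i = (\<Prod>j = 1..(i + 1) div 2. zz i j) / (\<Prod>j = 1..i div 2. zz (i - 1) j)"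

definition alpha_pm :: "(nat \<Rightarrow> real) \<Rightarrow> nat \<Rightarrow> real" where
  "alpha_pm a i = (if odd i then a ((i + 1) div 2) else - a (i div 2))"

definition Psi_integrand :: "nat \<Rightarrow> (nat \<Rightarrow> real) \<Rightarrow> (nat \<Rightarrow> real) \<Rightarrow> (nat \<times> nat \<Rightarrow> real) \<Rightarrow> real" where
  "Psi_integrand n a x z =
    (let zz = Psi_ext n z x in
      (\<Prod>i = 1..2 * n. so_type zz i powr alpha_pm a i)
      * exp (- (\<Sum>i = 1..2 * n - 1. \<Sum>j = 1..(i + 1) div 2.
                  zz (i + 1) (j + 1) / zz i j + zz i j / zz (i + 1) j)))"

definition Psi_so :: "nat \<Rightarrow> (nat \<Rightarrow> real) \<Rightarrow> (nat \<Rightarrow> real) \<Rightarrow> ennreal" where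
  "Psi_so n a x = (\<integral>\<^sup>+ z. ennreal (Psi_integrand n a x z) \<partial>(PiM (Psi_vars n) (\<lambda>_. haar_pos)))"

end

theory Submission
  imports Defs
begin

text \<open>
  The inverse-gamma weights \<open>w\<close> are transformed by a geometric RSK correspondence on the
  trapezoid, built by adding boxes one at a time. Adding the box \<open>(p, q)\<close> multiplies \<open>w (p, q)\<close> by the
  sum of its two predecessors and replaces every earlier entry \<open>t\<close> on the same diagonal by
  \<open>A / (B t)\<close>, where \<open>A\<close> is the sum of the predecessors of \<open>t\<close> and \<open>B\<close> the sum of the reciprocals of
  its successors. The factors \<open>A\<close> and \<open>B\<close> involve neighbouring diagonals only, so each such move
  preserves the product of the measures \<open>dt / t\<close>, and \<open>A / t + B t\<close> is unchanged; hence
  \<open>\<Sum> 1 / w\<close> becomes the sum of \<open>t\<close>-ratios over the edges of the shape. On the border, \<open>t\<close> is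
  the point-to-point partition function and the product of \<open>t\<close> along a diagonal is the product of
  \<open>w\<close> over a rectangle of the symmetrised array; the alternating product along the main diagonal
  gives \<open>\<Prod> w (i, i)\<close>. After the inversion \<open>s = 1 / (r t)\<close>, the first \<open>m + 1\<close> diagonals
  of \<open>s\<close> are the variables of \<open>T\<close> and \<open>x\<close>, the others are those of the Whittaker function, and
  the two integrands agree termwise.
\<close>

subsection \<open>The multiplicative Haar measure\<close>

lemma sets_haar_pos [simp, measurable_cong]: "sets haar_pos = sets borel"
  by (simp add: haar_pos_def)

lemma space_haar_pos [simp]: "space haar_pos = UNIV"
  by (simp add: haar_pos_def)

lemma measurable_haar_pos_iff [simp]: "f \<in> measurable M haar_pos \<longleftrightarrow> f \<in> borel_measurable M"
  by (simp only: measurable_cong_sets[OF refl sets_haar_pos])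

lemma sigma_finite_haar_pos: "sigma_finite_measure haar_pos"
proof -
  show ?thesis
    unfolding haar_pos_def by (subst sigma_finite_measure.sigma_finite_iff_density_finite[OF sigma_finite_lborel]) auto
qed

interpretation haar: product_sigma_finite "\<lambda>_. haar_pos"
  by (simp add: product_sigma_finite_def sigma_finite_haar_pos)

lemma nn_integral_haar_pos:
  assumes [measurable]: "f \<in> borel_measurable borel"
  shows "(\<integral>\<^sup>+ t. f t \<partial>haar_pos) = (\<integral>\<^sup>+ u. f (exp u) \<partial>lborel)"
proof -
  define g where "g = (\<lambda>t::real. ennreal (if t > 0 then 1 / t else 0) * f t)"
  have g[measurable]: "g \<in> borel_measurable borel" unfolding g_def by measurable
  have part: "(\<integral>\<^sup>+ t. g t * indicator {exp (- real (Suc N))..exp (real (Suc N))} t \<partial>lborel)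
      = (\<integral>\<^sup>+ u. f (exp u) * indicator {- real (Suc N)..real (Suc N)} u \<partial>lborel)" for N
  proof -
    have "(\<integral>\<^sup>+ t. g t * indicator {exp (- real (Suc N))..exp (real (Suc N))} t \<partial>lborel)
        = (\<integral>\<^sup>+ u. g (exp u) * ennreal (exp u) * indicator {- real (Suc N)..real (Suc N)} u \<partial>lborel)"
      by (rule nn_integral_substitution_aux) (auto intro!: derivative_eq_intros continuous_intros)
    also have "\<dots> = (\<integral>\<^sup>+ u. f (exp u) * indicator {- real (Suc N)..real (Suc N)} u \<partial>lborel)"
    proof (intro nn_integral_cong)
      fix u :: real
      have "ennreal (1 / exp u) * ennreal (exp u) = 1"
        by (simp flip: ennreal_mult)
      then show "g (exp u) * ennreal (exp u) * indicator {- real (Suc N)..real (Suc N)} u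
          = f (exp u) * indicator {- real (Suc N)..real (Suc N)} u"
        unfolding g_def by (simp add: mult.commute[of "ennreal (1 / exp u)"] mult.assoc)
    qed
    finally show ?thesis .
  qed
  have ex: "\<exists>N. - real (Suc N) \<le> u \<and> u \<le> real (Suc N)" for u
  proof -
    obtain N where "\<bar>u\<bar> \<le> real N" using real_arch_simple by blast
    then show ?thesis by (intro exI[of _ N]) auto
  qed
  have "(\<integral>\<^sup>+ t. f t \<partial>haar_pos) = (\<integral>\<^sup>+ t. g t \<partial>lborel)"
    unfolding haar_pos_def g_def by (subst nn_integral_density) auto
  also have "\<dots> = (\<integral>\<^sup>+ t. (SUP N. g t * indicator {exp (- real (Suc N))..exp (real (Suc N))} t) \<partial>lborel)"
  proof (intro nn_integral_cong antisym)
    fix t :: real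
    show "g t \<le> (SUP N. g t * indicator {exp (- real (Suc N))..exp (real (Suc N))} t)"
    proof (cases "t > 0")
      case True
      obtain N where N: "- real (Suc N) \<le> ln t" "ln t \<le> real (Suc N)" using ex by blast
      have "exp (- real (Suc N)) \<le> t \<and> t \<le> exp (real (Suc N))"
        using N True by (metis exp_le_cancel_iff exp_ln)
      then have "g t = g t * indicator {exp (- real (Suc N))..exp (real (Suc N))} t" by simp
      also have "\<dots> \<le> (SUP N. g t * indicator {exp (- real (Suc N))..exp (real (Suc N))} t)"
        by (rule SUP_upper) simp
      finally show ?thesis .
    qed (simp add: g_def)
  qed (auto intro!: SUP_least split: split_indicator)
  also have "\<dots> = (SUP N. \<integral>\<^sup>+ t. g t * indicator {exp (- real (Suc N))..exp (real (Suc N))} t \<partial>lborel)"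
  proof (intro nn_integral_monotone_convergence_SUP incseq_SucI le_funI)
    fix N :: nat and t :: real
    have "{exp (- real (Suc N))..exp (real (Suc N))} \<subseteq> {exp (- real (Suc (Suc N)))..exp (real (Suc (Suc N)))}"
      by (rule atLeastatMost_subset_iff[THEN iffD2]) simp
    then show "g t * indicator {exp (- real (Suc N))..exp (real (Suc N))} t
        \<le> g t * indicator {exp (- real (Suc (Suc N)))..exp (real (Suc (Suc N)))} t"
      by (intro mult_left_mono) (auto simp only: ennreal_indicator_less zero_le)
  qed measurable
  also have "\<dots> = (SUP N. \<integral>\<^sup>+ u. f (exp u) * indicator {- real (Suc N)..real (Suc N)} u \<partial>lborel)"
    by (simp only: part)
  also have "\<dots> = (\<integral>\<^sup>+ u. (SUP N. f (exp u) * indicator {- real (Suc N)..real (Suc N)} u) \<partial>lborel)"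
    by (intro nn_integral_monotone_convergence_SUP[symmetric])
       (auto simp: incseq_def le_fun_def split: split_indicator)
  also have "\<dots> = (\<integral>\<^sup>+ u. f (exp u) \<partial>lborel)"
  proof (intro nn_integral_cong antisym)
    fix u :: real
    obtain N where N: "- real (Suc N) \<le> u" "u \<le> real (Suc N)" using ex by blast
    then have "f (exp u) = f (exp u) * indicator {- real (Suc N)..real (Suc N)} u" by simp
    also have "\<dots> \<le> (SUP N. f (exp u) * indicator {- real (Suc N)..real (Suc N)} u)"
      by (rule SUP_upper) simp
    finally show "f (exp u) \<le> (SUP N. f (exp u) * indicator {- real (Suc N)..real (Suc N)} u)" .
  qed (auto intro!: SUP_least split: split_indicator)
  finally show ?thesis .
qed

lemma nn_integral_haar_pos_mult:
  assumes [measurable]: "f \<in> borel_measurable borel" and "c > 0"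
  shows "(\<integral>\<^sup>+ t. f (c * t) \<partial>haar_pos) = (\<integral>\<^sup>+ t. f t \<partial>haar_pos)"
proof -
  have "(\<integral>\<^sup>+ t. f t \<partial>haar_pos) = (\<integral>\<^sup>+ u. f (exp (ln c + 1 * u)) \<partial>lborel)"
    by (subst nn_integral_haar_pos, simp, subst nn_integral_real_affine[where c = 1 and t = "ln c"]) auto
  also have "\<dots> = (\<integral>\<^sup>+ t. f (c * t) \<partial>haar_pos)"
    using \<open>c > 0\<close> by (subst nn_integral_haar_pos) (auto simp: exp_add)
  finally show ?thesis ..
qed

lemma nn_integral_haar_pos_divide:
  assumes [measurable]: "f \<in> borel_measurable borel" and "c > 0"
  shows "(\<integral>\<^sup>+ t. f (c / t) \<partial>haar_pos) = (\<integral>\<^sup>+ t. f t \<partial>haar_pos)"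
proof -
  have "(\<integral>\<^sup>+ t. f t \<partial>haar_pos) = (\<integral>\<^sup>+ u. f (exp (ln c + (-1) * u)) \<partial>lborel)"
    by (subst nn_integral_haar_pos, simp, subst nn_integral_real_affine[where c = "-1" and t = "ln c"]) auto
  also have "\<dots> = (\<integral>\<^sup>+ t. f (c / t) \<partial>haar_pos)"
    using \<open>c > 0\<close> by (subst nn_integral_haar_pos) (auto simp: exp_diff)
  finally show ?thesis ..
qed

abbreviation haar_prod :: "'i set \<Rightarrow> ('i \<Rightarrow> real) measure" where
  "haar_prod I \<equiv> PiM I (\<lambda>_. haar_pos)"

lemma AE_haar_prod_pos:
  assumes "finite I"
  shows "AE v in haar_prod I. \<forall>i\<in>I. v i > 0"
proof -
  have "AE v in haar_prod I. v i > 0" if i: "i \<in> I" for i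
  proof (rule AE_I')
    let ?A = "\<lambda>j. if j = i then {..0::real} else UNIV"
    have "emeasure haar_pos {..0} = 0"
      unfolding haar_pos_def by (subst emeasure_density) (auto intro!: nn_integral_0_iff_AE[THEN iffD2] simp: indicator_def)
    then have "emeasure (haar_prod I) (Pi\<^sub>E I ?A) = 0"
      using assms i by (subst haar.emeasure_PiM) (auto intro!: bexI[of _ i])
    then show "Pi\<^sub>E I ?A \<in> null_sets (haar_prod I)"
      using assms by (auto simp: null_sets_def intro!: sets_PiM_I_finite)
    show "{v \<in> space (haar_prod I). \<not> v i > 0} \<subseteq> Pi\<^sub>E I ?A"
      by (auto simp: space_PiM PiE_iff extensional_def)
  qed
  then show ?thesis using assms by (simp add: AE_finite_all)
qed

lemma measurable_haar_prod_coord [measurable]: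
  "(\<lambda>v. v i) \<in> borel_measurable (haar_prod I)"
proof (cases "i \<in> I")
  case True
  then show ?thesis
    using measurable_component_singleton[OF True, of "\<lambda>_. haar_pos"] by simp
next
  case False
  then have "v \<in> space (haar_prod I) \<Longrightarrow> v i = undefined" for v
    by (auto simp: space_PiM PiE_iff extensional_def)
  then show ?thesis by (subst measurable_cong[where g = "\<lambda>_. undefined"]) auto
qed

definition haar_preserving :: "'i set \<Rightarrow> (('i \<Rightarrow> real) \<Rightarrow> ('i \<Rightarrow> real)) \<Rightarrow> bool" where
  "haar_preserving I \<Phi> \<longleftrightarrow> \<Phi> \<in> measurable (haar_prod I) (haar_prod I) \<and>
     (\<forall>f \<in> borel_measurable (haar_prod I). (\<integral>\<^sup>+ v. f (\<Phi> v) \<partial>haar_prod I) = (\<integral>\<^sup>+ v. f v \<partial>haar_prod I))"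

lemma haar_preserving_id: "haar_preserving I (\<lambda>v. v)"
  by (simp add: haar_preserving_def)

lemma haar_preserving_comp:
  assumes "haar_preserving I \<Phi>" "haar_preserving I \<Psi>"
  shows "haar_preserving I (\<lambda>v. \<Psi> (\<Phi> v))"
  unfolding haar_preserving_def
proof (intro conjI ballI)
  show "(\<lambda>v. \<Psi> (\<Phi> v)) \<in> measurable (haar_prod I) (haar_prod I)"
    using assms by (auto simp: haar_preserving_def intro: measurable_compose)
  fix f :: "('a \<Rightarrow> real) \<Rightarrow> ennreal" assume f: "f \<in> borel_measurable (haar_prod I)"
  then have "(\<lambda>v. f (\<Psi> v)) \<in> borel_measurable (haar_prod I)"
    using assms by (auto simp: haar_preserving_def intro: measurable_compose)
  then show "(\<integral>\<^sup>+ v. f (\<Psi> (\<Phi> v)) \<partial>haar_prod I) = (\<integral>\<^sup>+ v. f v \<partial>haar_prod I)"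
    using assms f by (auto simp: haar_preserving_def)
qed

lemma haar_preserving_update:
  fixes c :: "('i \<Rightarrow> real) \<Rightarrow> real"
  assumes "finite I" "x \<in> I"
    and c[measurable]: "c \<in> borel_measurable (haar_prod I)"
    and indep: "\<And>v y. c (v(x := y)) = c v"
    and pos: "\<And>v. (\<And>i. i \<in> I \<Longrightarrow> v i > 0) \<Longrightarrow> c v > 0"
    and h[measurable]: "case_prod h \<in> borel_measurable (borel \<Otimes>\<^sub>M borel)"
    and inv: "\<And>a g. a > 0 \<Longrightarrow> g \<in> borel_measurable borel \<Longrightarrow>
        (\<integral>\<^sup>+ t. g (h a t) \<partial>haar_pos) = (\<integral>\<^sup>+ t. g t \<partial>haar_pos)"
  shows "haar_preserving I (\<lambda>v. v(x := h (c v) (v x)))"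
proof -
  let ?U = "\<lambda>v. v(x := h (c v) (v x))"
  define J where "J = I - {x}"
  have I: "I = insert x J" and J: "finite J" "x \<notin> J"
    using \<open>finite I\<close> \<open>x \<in> I\<close> by (auto simp: J_def)
  have U[measurable]: "?U \<in> measurable (haar_prod I) (haar_prod I)"
    unfolding fun_upd_def
  proof (rule measurable_PiM_single')
    fix i assume "i \<in> I"
    have "(\<lambda>v. h (c v) (v x)) \<in> borel_measurable (haar_prod I)"
      using measurable_compose[OF measurable_Pair[OF c measurable_haar_prod_coord] h] by simp
    then have "(\<lambda>v. if i = x then h (c v) (v x) else v i) \<in> borel_measurable (haar_prod I)"
      by (cases "i = x") simp_all
    then show "(\<lambda>v. if i = x then h (c v) (v x) else v i) \<in> measurable (haar_prod I) haar_pos"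
      using measurable_cong_sets[OF refl sets_haar_pos] by blast
  next
    show "(\<lambda>v i. if i = x then h (c v) (v x) else v i)
        \<in> space (haar_prod I) \<rightarrow> (\<Pi>\<^sub>E i\<in>I. space haar_pos)"
      using \<open>x \<in> I\<close> by (auto simp only: space_PiM PiE_iff extensional_def space_haar_pos split: if_splits)
  qed
  show ?thesis
    unfolding haar_preserving_def
  proof (intro conjI ballI)
    show "?U \<in> measurable (haar_prod I) (haar_prod I)" by (rule U)
    fix f :: "('i \<Rightarrow> real) \<Rightarrow> ennreal" assume f[measurable]: "f \<in> borel_measurable (haar_prod I)"
    have "(\<integral>\<^sup>+ v. f (?U v) \<partial>haar_prod I)
        = (\<integral>\<^sup>+ v. (\<integral>\<^sup>+ y. f (?U (v(x := y))) \<partial>haar_pos) \<partial>haar_prod J)"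
      unfolding I by (rule haar.product_nn_integral_insert[OF J]) (unfold I[symmetric], measurable)
    also have "\<dots> = (\<integral>\<^sup>+ v. (\<integral>\<^sup>+ y. f (v(x := h (c (v(x := 1))) y)) \<partial>haar_pos) \<partial>haar_prod J)"
      by (simp add: indep)
    also have "\<dots> = (\<integral>\<^sup>+ v. (\<integral>\<^sup>+ y. f (v(x := y)) \<partial>haar_pos) \<partial>haar_prod J)"
    proof (rule nn_integral_cong_AE)
      have "AE v in haar_prod J. v \<in> space (haar_prod J) \<and> (\<forall>i\<in>J. v i > 0)"
        using AE_haar_prod_pos[OF J(1)] by auto
      then show "AE v in haar_prod J. (\<integral>\<^sup>+ y. f (v(x := h (c (v(x := 1))) y)) \<partial>haar_pos)
          = (\<integral>\<^sup>+ y. f (v(x := y)) \<partial>haar_pos)"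
      proof (rule AE_mp, intro AE_I2 impI, elim conjE)
        fix v assume v: "v \<in> space (haar_prod J)" "\<forall>i\<in>J. v i > 0"
        have "c (v(x := 1)) > 0" by (rule pos) (use v I in auto)
        moreover have "(\<lambda>y. f (v(x := y))) \<in> borel_measurable borel"
          using measurable_comp[OF measurable_component_update[OF v(1) J(2)] f[unfolded I]]
          by (simp add: comp_def)
        ultimately show "(\<integral>\<^sup>+ y. f (v(x := h (c (v(x := 1))) y)) \<partial>haar_pos)
          = (\<integral>\<^sup>+ y. f (v(x := y)) \<partial>haar_pos)"
          using inv[of "c (v(x := 1))" "\<lambda>y. f (v(x := y))"] by simp
      qed
    qed
    also have "\<dots> = (\<integral>\<^sup>+ v. f v \<partial>haar_prod I)"
      unfolding I by (rule haar.product_nn_integral_insert[symmetric, OF J]) (unfold I[symmetric], measurable)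
    finally show "(\<integral>\<^sup>+ v. f (?U v) \<partial>haar_prod I) = (\<integral>\<^sup>+ v. f v \<partial>haar_prod I)" .
  qed
qed

lemma haar_preserving_scale:
  assumes "finite I" "x \<in> I" "c \<in> borel_measurable (haar_prod I)"
    and "\<And>v y. c (v(x := y)) = c v"
    and "\<And>v. (\<And>i. i \<in> I \<Longrightarrow> v i > 0) \<Longrightarrow> c v > 0"
  shows "haar_preserving I (\<lambda>v. v(x := c v * v x))"
  by (rule haar_preserving_update[where h = "\<lambda>a t. a * t"])
     (use assms nn_integral_haar_pos_mult in auto)

lemma haar_preserving_invert:
  assumes "finite I" "x \<in> I" "c \<in> borel_measurable (haar_prod I)"
    and "\<And>v y. c (v(x := y)) = c v"
    and "\<And>v. (\<And>i. i \<in> I \<Longrightarrow> v i > 0) \<Longrightarrow> c v > 0"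
  shows "haar_preserving I (\<lambda>v. v(x := c v / v x))"
  by (rule haar_preserving_update[where h = "\<lambda>a t. a / t"])
     (use assms nn_integral_haar_pos_divide in auto)

lemma nn_integral_haar_prod_reindex:
  assumes "finite J" and h: "inj_on h J" and f[measurable]: "f \<in> borel_measurable (haar_prod J)"
  shows "(\<integral>\<^sup>+ v. f (\<lambda>j\<in>J. v (h j)) \<partial>haar_prod (h ` J)) = (\<integral>\<^sup>+ v. f v \<partial>haar_prod J)"
proof -
  let ?R = "\<lambda>v. \<lambda>j\<in>J. v (h j)"
  have R[measurable]: "?R \<in> measurable (haar_prod (h ` J)) (haar_prod J)"
  proof (rule measurable_restrict)
    fix j show "(\<lambda>v. v (h j)) \<in> measurable (haar_prod (h ` J)) haar_pos"
      by (simp only: measurable_haar_pos_iff measurable_haar_prod_coord)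
  qed
  have "distr (haar_prod (h ` J)) (haar_prod J) ?R = haar_prod J"
  proof (rule haar.PiM_eqI[OF \<open>finite J\<close>])
    fix A :: "'a \<Rightarrow> real set" assume A: "\<And>i. i \<in> J \<Longrightarrow> A i \<in> sets haar_pos"
    have "?R -` Pi\<^sub>E J A \<inter> space (haar_prod (h ` J)) = Pi\<^sub>E (h ` J) (\<lambda>k. A (the_inv_into J h k))"
      using h by (auto simp: space_PiM PiE_iff the_inv_into_f_f)
    then have "emeasure (distr (haar_prod (h ` J)) (haar_prod J) ?R) (Pi\<^sub>E J A)
        = emeasure (haar_prod (h ` J)) (Pi\<^sub>E (h ` J) (\<lambda>k. A (the_inv_into J h k)))"
      using A \<open>finite J\<close> by (subst emeasure_distr) (auto intro!: sets_PiM_I_finite)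
    also have "\<dots> = (\<Prod>k\<in>h ` J. emeasure haar_pos (A (the_inv_into J h k)))"
      using A \<open>finite J\<close> h by (intro haar.emeasure_PiM) (auto simp: the_inv_into_f_f)
    also have "\<dots> = (\<Prod>j\<in>J. emeasure haar_pos (A j))"
      using h by (simp add: prod.reindex the_inv_into_f_f)
    finally show "emeasure (distr (haar_prod (h ` J)) (haar_prod J) ?R) (Pi\<^sub>E J A)
        = (\<Prod>j\<in>J. emeasure haar_pos (A j))" .
  qed simp
  then show ?thesis
    using nn_integral_distr[OF R, of f] f by simp
qed

subsection \<open>Geometric RSK on shifted shapes\<close>

definition shifted_shape :: "(nat \<times> nat) set \<Rightarrow> bool" where
  "shifted_shape S \<longleftrightarrow> (\<forall>i j. (i, j) \<in> S \<longrightarrow> 1 \<le> i \<and> i \<le> j \<and>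
     (\<forall>i' j'. 1 \<le> i' \<longrightarrow> i' \<le> i \<longrightarrow> i' \<le> j' \<longrightarrow> j' \<le> j \<longrightarrow> (i', j') \<in> S))"

definition inflow :: "(nat \<times> nat \<Rightarrow> real) \<Rightarrow> nat \<Rightarrow> nat \<Rightarrow> real" where
  "inflow v i j = (if i = 1 \<and> j = 1 then 1
     else (if 1 < i then v (i - 1, j) else 0) + (if i < j then v (i, j - 1) else 0))"

definition outflow :: "(nat \<times> nat \<Rightarrow> real) \<Rightarrow> nat \<Rightarrow> nat \<Rightarrow> real" where
  "outflow v i j = 1 / v (i, j + 1) + (if i < j then 1 / v (i + 1, j) else 0)"

definition energy :: "(nat \<times> nat) set \<Rightarrow> (nat \<times> nat \<Rightarrow> real) \<Rightarrow> real" where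
  "energy S v = (\<Sum>(i, j)\<in>S. inflow v i j / v (i, j))"

definition toggle :: "nat \<Rightarrow> nat \<Rightarrow> (nat \<times> nat \<Rightarrow> real) \<Rightarrow> nat \<times> nat \<Rightarrow> real" where
  "toggle i j v = v((i, j) := inflow v i j / outflow v i j / v (i, j))"

primrec toggle_diagonal :: "nat \<Rightarrow> nat \<Rightarrow> (nat \<times> nat \<Rightarrow> real) \<Rightarrow> nat \<times> nat \<Rightarrow> real" where
  "toggle_diagonal d 0 v = v"
| "toggle_diagonal d (Suc k) v = toggle (Suc k) (Suc k + d) (toggle_diagonal d k v)"

definition add_box :: "nat \<Rightarrow> nat \<Rightarrow> (nat \<times> nat \<Rightarrow> real) \<Rightarrow> nat \<times> nat \<Rightarrow> real" where
  "add_box p q v = (let u = toggle_diagonal (q - p) (p - 1) v in u((p, q) := inflow u p q * u (p, q)))"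

lemma shifted_shapeD:
  assumes "shifted_shape S" "(i, j) \<in> S"
  shows "1 \<le> i" "i \<le> j" "\<And>i' j'. 1 \<le> i' \<Longrightarrow> i' \<le> i \<Longrightarrow> i' \<le> j' \<Longrightarrow> j' \<le> j \<Longrightarrow> (i', j') \<in> S"
  using assms unfolding shifted_shape_def by blast+

lemma inflow_cong_diagonal:
  assumes "\<And>a b. b \<noteq> a + d \<Longrightarrow> u (a, b) = v (a, b)"
  shows "inflow u i (i + d) = inflow v i (i + d)"
  using assms by (auto simp: inflow_def)

lemma outflow_cong_diagonal:
  assumes "\<And>a b. b \<noteq> a + d \<Longrightarrow> u (a, b) = v (a, b)"
  shows "outflow u i (i + d) = outflow v i (i + d)"
  using assms by (auto simp: outflow_def)

lemma toggle_diagonal_apply: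
  "toggle_diagonal d k v (i, j) = (if 1 \<le> i \<and> i \<le> k \<and> j = i + d
     then inflow v i j / outflow v i j / v (i, j) else v (i, j))"
proof (induction k arbitrary: i j)
  case (Suc k)
  have "inflow (toggle_diagonal d k v) (Suc k) (Suc k + d) = inflow v (Suc k) (Suc k + d)"
    "outflow (toggle_diagonal d k v) (Suc k) (Suc k + d) = outflow v (Suc k) (Suc k + d)"
    by (auto intro!: inflow_cong_diagonal outflow_cong_diagonal simp del: add_Suc simp: Suc.IH)
  then show ?case
    using Suc.IH by (auto simp: toggle_def)
qed auto

lemma add_box_apply:
  assumes "1 \<le> p" "p \<le> q"
  shows "add_box p q v (i, j) = (if i = p \<and> j = q then inflow v p q * v (p, q)
     else if 1 \<le> i \<and> i < p \<and> j = i + (q - p) then inflow v i j / outflow v i j / v (i, j)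
     else v (i, j))"
proof -
  have "inflow (toggle_diagonal (q - p) (p - 1) v) p (p + (q - p)) = inflow v p (p + (q - p))"
    by (rule inflow_cong_diagonal) (auto simp: toggle_diagonal_apply)
  then show ?thesis
    using assms by (auto simp: add_box_def Let_def toggle_diagonal_apply)
qed

lemma inflow_pos:
  assumes S: "shifted_shape S" "(i, j) \<in> S" and pos: "\<And>x. x \<in> S \<Longrightarrow> v x > 0"
  shows "inflow v i j > 0"
proof -
  note * = shifted_shapeD[OF S]
  have "1 < i \<Longrightarrow> v (i - 1, j) > 0" using * by (intro pos *(3)) auto
  moreover have "i < j \<Longrightarrow> v (i, j - 1) > 0" using * by (intro pos *(3)) auto
  ultimately show ?thesis using * by (auto simp: inflow_def add_pos_pos)
qed

lemma outflow_pos: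
  assumes "v (i, j + 1) > 0" "i < j \<Longrightarrow> v (i + 1, j) > 0"
  shows "outflow v i j > 0"
  using assms by (auto simp: outflow_def add_pos_pos)

lemma toggle_pair_identity:
  fixes X :: real
  assumes "X > 0" "A > 0" "B > 0"
  shows "A / (A / B / X) + (A / B / X) * B = A / X + X * B"
  using assms by (simp add: field_simps)

lemma energy_toggle:
  assumes S: "shifted_shape S" "finite S" and "1 \<le> i" "i \<le> j"
    and x: "(i, j) \<in> S" and r: "(i, j + 1) \<in> S" and dn: "i < j \<Longrightarrow> (i + 1, j) \<in> S"
    and pos: "\<And>x. x \<in> S \<Longrightarrow> v x > 0"
  shows "energy S (toggle i j v) = energy S v"
proof -
  define u where "u = toggle i j v"
  define T where "T = {(i, j), (i, j + 1)} \<union> (if i < j then {(i + 1, j)} else {})"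
  let ?f = "\<lambda>v (a, b). inflow v a b / v (a, b)"
  have T: "T \<subseteq> S" "finite T" using x r dn by (auto simp: T_def)
  have uv: "u y = v y" if "y \<noteq> (i, j)" for y using that by (simp add: u_def toggle_def)
  have uij: "u (i, j) = inflow v i j / outflow v i j / v (i, j)" by (simp add: u_def toggle_def)
  have out: "outflow v i j > 0" using pos r dn by (intro outflow_pos) auto
  have inf: "inflow v i j > 0" by (rule inflow_pos[OF S(1) x pos])
  have rest: "(\<Sum>y\<in>S - T. ?f u y) = (\<Sum>y\<in>S - T. ?f v y)"
  proof (intro sum.cong refl)
    fix y assume y: "y \<in> S - T"
    obtain a b where ab: "y = (a, b)" by (cases y)
    have "1 \<le> a" "a \<le> b" using shifted_shapeD(1,2)[OF S(1), of a b] y ab by auto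
    have "(a, b) \<noteq> (i, j)" using y ab by (auto simp: T_def)
    moreover have "1 < a \<Longrightarrow> (a - 1, b) \<noteq> (i, j)" using y ab \<open>a \<le> b\<close> by (auto simp: T_def split: if_splits)
    moreover have "a < b \<Longrightarrow> (a, b - 1) \<noteq> (i, j)" using y ab by (auto simp: T_def split: if_splits)
    ultimately show "?f u y = ?f v y" by (auto simp: ab inflow_def uv)
  qed
  have inx: "inflow u i j = inflow v i j"
    using \<open>1 \<le> i\<close> by (auto simp: inflow_def uv)
  have inr: "inflow u i (j + 1) = inflow v i (j + 1) + (u (i, j) - v (i, j))"
    using \<open>1 \<le> i\<close> \<open>i \<le> j\<close> by (auto simp: inflow_def uv)
  have ind: "inflow u (i + 1) j = inflow v (i + 1) j + (u (i, j) - v (i, j))" if "i < j"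
    using \<open>1 \<le> i\<close> that by (auto simp: inflow_def uv)
  have *: "(\<Sum>y\<in>T. ?f v y) = inflow v i j / v (i, j) + inflow v i (j + 1) / v (i, j + 1)
      + (if i < j then inflow v (i + 1) j / v (i + 1, j) else 0)" for v
    using \<open>i \<le> j\<close> by (simp add: T_def)
  have key: "inflow v i j / u (i, j) + u (i, j) * outflow v i j
      = inflow v i j / v (i, j) + v (i, j) * outflow v i j"
    unfolding uij by (rule toggle_pair_identity) (use inf out pos x in auto)
  have "(\<Sum>y\<in>T. ?f u y) - (\<Sum>y\<in>T. ?f v y)
      = inflow v i j / u (i, j) - inflow v i j / v (i, j) + (u (i, j) - v (i, j)) * outflow v i j"
    using \<open>i \<le> j\<close> unfolding * by (auto simp: inx inr[simplified] ind[simplified] uv outflow_def add_divide_distrib distrib_left)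
  also have "\<dots> = 0" using key by (simp add: algebra_simps)
  finally have "(\<Sum>y\<in>T. ?f u y) = (\<Sum>y\<in>T. ?f v y)" by simp
  then show ?thesis
    unfolding energy_def u_def[symmetric] using sum.subset_diff[OF T(1) S(2), of "?f u"] sum.subset_diff[OF T(1) S(2), of "?f v"] rest
    by simp
qed

lemma toggle_diagonal_pos:
  assumes S: "shifted_shape S" "(p, p + d) \<in> S" "Suc k \<le> p" and pos: "\<And>x. x \<in> S - {(p, p + d)} \<Longrightarrow> v x > 0"
    and x: "x \<in> S - {(p, p + d)}"
  shows "toggle_diagonal d k v x > 0"
proof -
  obtain i j where ij: "x = (i, j)" by (cases x)
  note * = shifted_shapeD(3)[OF S(1,2)]
  show ?thesis
  proof (cases "1 \<le> i \<and> i \<le> k \<and> j = i + d")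
    case True
    have "1 < i \<Longrightarrow> v (i - 1, j) > 0"  using True S(3) by (intro pos) (auto intro!: *)
    moreover have "i < j \<Longrightarrow> v (i, j - 1) > 0" using True S(3) by (intro pos) (auto intro!: *)
    ultimately have "inflow v i j > 0" using True by (auto simp: inflow_def add_pos_pos)
    moreover have "outflow v i j > 0"
      using True S(3) by (intro outflow_pos pos) (auto intro!: *)
    ultimately show ?thesis using pos[OF x] ij True by (simp add: toggle_diagonal_apply)
  qed (use pos[OF x] ij in \<open>auto simp: toggle_diagonal_apply\<close>)
qed

lemma shifted_shape_remove_corner:
  assumes S: "shifted_shape S" and c: "\<And>i j. (i, j) \<in> S \<Longrightarrow> p \<le> i \<Longrightarrow> q \<le> j \<Longrightarrow> (i, j) = (p, q)"
  shows "shifted_shape (S - {(p, q)})"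
  unfolding shifted_shape_def
proof (intro allI impI)
  fix i j assume "(i, j) \<in> S - {(p, q)}"
  with shifted_shapeD[OF S, of i j] c[of i j]
  show "1 \<le> i \<and> i \<le> j \<and> (\<forall>i' j'. 1 \<le> i' \<longrightarrow> i' \<le> i \<longrightarrow> i' \<le> j' \<longrightarrow> j' \<le> j \<longrightarrow> (i', j') \<in> S - {(p, q)})"
    by auto
qed

lemma energy_toggle_diagonal:
  assumes S: "shifted_shape S" "finite S" and S': "shifted_shape (insert (p, p + d) S)" "(p, p + d) \<notin> S"
    and k: "Suc k \<le> p" and pos: "\<And>x. x \<in> S \<Longrightarrow> v x > 0"
  shows "energy S (toggle_diagonal d k v) = energy S v"
  using k
proof (induction k)
  case (Suc k)
  note * = shifted_shapeD(3)[OF S'(1) insertI1]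
  have mem: "(a, b) \<in> S" if "1 \<le> a" "a \<le> p" "a \<le> b" "b \<le> p + d" "a < p \<or> b < p + d" for a b
    using *[OF that(1-4)] that(5) by auto
  have "energy S (toggle (Suc k) (Suc k + d) (toggle_diagonal d k v)) = energy S (toggle_diagonal d k v)"
  proof (rule energy_toggle[OF S])
    fix x assume "x \<in> S"
    then show "0 < toggle_diagonal d k v x"
      using S'(2) Suc.prems pos by (intro toggle_diagonal_pos[OF S'(1)]) auto
  qed (use Suc.prems in \<open>auto intro!: mem\<close>)
  then show ?case using Suc by simp
qed simp

lemma energy_add_box:
  assumes S: "shifted_shape S" "finite S" and S': "shifted_shape (insert (p, q) S)" "(p, q) \<notin> S"
    and pos: "\<And>x. x \<in> insert (p, q) S \<Longrightarrow> v x > 0"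
  shows "energy (insert (p, q) S) (add_box p q v) = energy S v + 1 / v (p, q)"
proof -
  have pq: "1 \<le> p" "p \<le> q" using shifted_shapeD[OF S'(1) insertI1] by auto
  define u where "u = toggle_diagonal (q - p) (p - 1) v"
  have "inflow (add_box p q v) i j / add_box p q v (i, j) = inflow u i j / u (i, j)" if "(i, j) \<in> S" for i j
  proof -
    have n: "\<not> (p \<le> i \<and> q \<le> j)" using shifted_shapeD[OF S(1) that] S'(2) pq by auto
    have e: "add_box p q v (a, b) = u (a, b)" if "\<not> (p \<le> a \<and> q \<le> b)" for a b
      using that by (auto simp: add_box_def u_def Let_def)
    have "add_box p q v (i, j) = u (i, j)" "add_box p q v (i - 1, j) = u (i - 1, j)"
      "add_box p q v (i, j - 1) = u (i, j - 1)"
      using n by (auto intro!: e)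
    then show ?thesis by (simp add: inflow_def)
  qed
  then have "(\<Sum>(i, j)\<in>S. inflow (add_box p q v) i j / add_box p q v (i, j)) = energy S u"
    unfolding energy_def by (intro sum.cong) auto
  also have "energy S u = energy S v"
    unfolding u_def using pq S' pos by (intro energy_toggle_diagonal[OF S, where p = p]) auto
  finally have e: "(\<Sum>(i, j)\<in>S. inflow (add_box p q v) i j / add_box p q v (i, j)) = energy S v" .
  have "inflow (add_box p q v) p (p + (q - p)) = inflow v p (p + (q - p))"
    by (rule inflow_cong_diagonal) (use pq in \<open>auto simp: add_box_apply\<close>)
  moreover have "inflow v p q > 0" by (rule inflow_pos[OF S'(1) insertI1 pos])
  ultimately have "inflow (add_box p q v) p q / add_box p q v (p, q) = 1 / v (p, q)"
    using pq by (simp add: add_box_apply)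
  with e show ?thesis
    unfolding energy_def using S S' by simp
qed

lemma haar_preserving_add_box:
  assumes I: "finite I" "S \<subseteq> I" and S: "shifted_shape S" "(p, q) \<in> S"
  shows "haar_preserving I (add_box p q)"
proof -
  have pq: "1 \<le> p" "p \<le> q" using shifted_shapeD[OF S] by auto
  have mem: "(a, b) \<in> I" if "1 \<le> a" "a \<le> p" "a \<le> b" "b \<le> q" for a b
    using shifted_shapeD(3)[OF S that] I by auto
  have [measurable]: "(\<lambda>v. inflow v i j) \<in> borel_measurable (haar_prod I)"
    "(\<lambda>v. outflow v i j) \<in> borel_measurable (haar_prod I)" for i j
    unfolding inflow_def outflow_def by measurable
  have inf: "inflow v i j > 0" if "1 \<le> i" "i \<le> p" "i \<le> j" "j \<le> q" "\<And>x. x \<in> I \<Longrightarrow> v x > 0" for v i j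
    by (rule inflow_pos[OF S(1)]) (use that I shifted_shapeD(3)[OF S] in auto)
  have tog: "haar_preserving I (toggle_diagonal (q - p) k)" if "k < p" for k
    using that
  proof (induction k)
    case 0
    then show ?case by (simp add: haar_preserving_id)
  next
    case (Suc k)
    have "haar_preserving I (toggle (Suc k) (Suc k + (q - p)))"
      unfolding toggle_def
    proof (rule haar_preserving_invert[OF I(1)])
      show "(Suc k, Suc k + (q - p)) \<in> I" using Suc.prems pq by (intro mem) auto
      fix v :: "nat \<times> nat \<Rightarrow> real" assume pos: "\<And>x. x \<in> I \<Longrightarrow> v x > 0"
      have "outflow v (Suc k) (Suc k + (q - p)) > 0"
        using Suc.prems pq by (intro outflow_pos pos mem) auto
      then show "0 < inflow v (Suc k) (Suc k + (q - p)) / outflow v (Suc k) (Suc k + (q - p))"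
        using Suc.prems pq by (intro divide_pos_pos inf pos) auto
    next
      fix v :: "nat \<times> nat \<Rightarrow> real" and y :: real
      show "inflow (v((Suc k, Suc k + (q - p)) := y)) (Suc k) (Suc k + (q - p)) /
           outflow (v((Suc k, Suc k + (q - p)) := y)) (Suc k) (Suc k + (q - p)) =
           inflow v (Suc k) (Suc k + (q - p)) / outflow v (Suc k) (Suc k + (q - p))"
        by (intro arg_cong2[where f = "(/)"] inflow_cong_diagonal outflow_cong_diagonal) auto
    qed measurable
    then show ?case
      using haar_preserving_comp[OF Suc.IH] Suc.prems by simp
  qed
  have "haar_preserving I (\<lambda>u. u((p, q) := inflow u p q * u (p, q)))"
  proof (rule haar_preserving_scale[OF I(1)])
    show "(p, q) \<in> I" using S I by auto
    show "0 < inflow v p q" if "\<And>x. x \<in> I \<Longrightarrow> v x > 0" for v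
      using inf[of p q v] that pq by auto
    show "inflow (v((p, q) := y)) p q = inflow v p q" for v y
      using inflow_cong_diagonal[of "q - p" "v((p, q) := y)" v p] pq by fastforce
  qed measurable
  with haar_preserving_comp[OF tog[of "p - 1"] this] pq
  show ?thesis unfolding add_box_def Let_def by simp
qed

definition sym_rect_prod :: "(nat \<times> nat \<Rightarrow> real) \<Rightarrow> nat \<Rightarrow> nat \<Rightarrow> real" where
  "sym_rect_prod w p q = (\<Prod>i = 1..p. \<Prod>j = 1..q. w (min i j, max i j))"

function path_sum :: "(nat \<times> nat \<Rightarrow> real) \<Rightarrow> nat \<Rightarrow> nat \<Rightarrow> real" where
  "path_sum w i j = (if i = 0 \<or> j < i then 0 else if i = 1 \<and> j = 1 then w (1, 1)
     else w (i, j) * (path_sum w (i - 1) j + path_sum w i (j - 1)))"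
  by auto
termination by (relation "Wellfounded.measure (\<lambda>(w, i, j). i + j)") auto

declare path_sum.simps [simp del]

primrec alternating_diag :: "(nat \<times> nat \<Rightarrow> real) \<Rightarrow> nat \<Rightarrow> real" where
  "alternating_diag v 0 = 1"
| "alternating_diag v (Suc k) = v (Suc k, Suc k) / alternating_diag v k"

definition diag_prod :: "(nat \<times> nat \<Rightarrow> real) \<Rightarrow> nat \<Rightarrow> nat \<Rightarrow> real" where
  "diag_prod v p d = (\<Prod>k = 1..p. v (k, k + d))"

lemma diag_prod_0 [simp]: "diag_prod v 0 d = 1"
  and diag_prod_Suc [simp]: "diag_prod v (Suc p) d = diag_prod v p d * v (Suc p, Suc p + d)"
  by (simp_all add: diag_prod_def)

lemma sym_rect_prod_commute: "sym_rect_prod w p q = sym_rect_prod w q p"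
  unfolding sym_rect_prod_def by (subst prod.swap) (simp add: min.commute max.commute)

lemma sym_rect_prod_0 [simp]: "sym_rect_prod w 0 q = 1"
  by (simp add: sym_rect_prod_def)

lemma sym_rect_prod_Suc:
  "sym_rect_prod w (Suc p) (Suc q) * sym_rect_prod w p q
     = w (min (Suc p) (Suc q), max (Suc p) (Suc q)) * sym_rect_prod w p (Suc q) * sym_rect_prod w (Suc p) q"
  by (simp add: sym_rect_prod_def prod.distrib mult_ac)

lemma path_sum_outside [simp]: "i = 0 \<or> j < i \<Longrightarrow> path_sum w i j = 0"
  by (subst path_sum.simps) auto

lemma path_sum_origin [simp]: "path_sum w (Suc 0) (Suc 0) = w (Suc 0, Suc 0)"
  by (subst path_sum.simps) auto

lemma path_sum_step:
  assumes "1 \<le> i" "i \<le> j" "\<not> (i = 1 \<and> j = 1)"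
  shows "path_sum w i j = w (i, j) * (path_sum w (i - 1) j + path_sum w i (j - 1))"
  using assms by (subst path_sum.simps) auto

lemma path_sum_inflow:
  assumes "1 \<le> i" "i \<le> j"
  shows "path_sum w i j = w (i, j) * inflow (\<lambda>(i, j). path_sum w i j) i j"
  using assms by (subst path_sum.simps) (auto simp: inflow_def)

lemma inflow_div_outflow:
  assumes "1 \<le> i" "v (i, i + d + 1) > 0" "0 < d \<Longrightarrow> v (Suc i, i + d) > 0"
  shows "inflow v (Suc i) (Suc i + d) / outflow v i (i + d)
      = v (i, i + d + 1) * (if 0 < d then v (Suc i, i + d) else v (i, i + d + 1))"
proof -
  have "inflow v (Suc i) (Suc i + d) = v (i, i + d + 1) + (if 0 < d then v (Suc i, i + d) else 0)"
    using assms(1) by (auto simp: inflow_def)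
  then show ?thesis
    using assms by (auto simp: outflow_def field_simps)
qed

lemma prod_inflow_div_outflow:
  assumes "\<And>i. 1 \<le> i \<Longrightarrow> i \<le> k \<Longrightarrow> v (i, i + d + 1) > 0"
    "\<And>i. 1 \<le> i \<Longrightarrow> i \<le> k \<Longrightarrow> 0 < d \<Longrightarrow> v (Suc i, i + d) > 0"
  shows "(\<Prod>i = 1..k. inflow v i (i + d) / outflow v i (i + d)) * inflow v (Suc k) (Suc k + d)
      = diag_prod v k (d + 1) * (if 0 < d then diag_prod v (Suc k) (d - 1) else diag_prod v k 1)"
  using assms
proof (induction k)
  case 0
  then show ?case by (auto simp: inflow_def)
next
  case (Suc k)
  have IH: "(\<Prod>i = 1..k. inflow v i (i + d) / outflow v i (i + d)) * inflow v (Suc k) (Suc k + d)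
      = diag_prod v k (d + 1) * (if 0 < d then diag_prod v (Suc k) (d - 1) else diag_prod v k 1)"
    using Suc.prems by (intro Suc.IH) auto
  have *: "inflow v (Suc (Suc k)) (Suc (Suc k) + d) / outflow v (Suc k) (Suc k + d)
      = v (Suc k, Suc k + d + 1) * (if 0 < d then v (Suc (Suc k), Suc k + d) else v (Suc k, Suc k + d + 1))"
    using Suc.prems(1)[of "Suc k"] Suc.prems(2)[of "Suc k"] by (intro inflow_div_outflow) auto
  have "(\<Prod>i = 1..Suc k. inflow v i (i + d) / outflow v i (i + d)) * inflow v (Suc (Suc k)) (Suc (Suc k) + d)
     = ((\<Prod>i = 1..k. inflow v i (i + d) / outflow v i (i + d)) * inflow v (Suc k) (Suc k + d))
       * (inflow v (Suc (Suc k)) (Suc (Suc k) + d) / outflow v (Suc k) (Suc k + d))"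
    by simp
  also have "\<dots> = diag_prod v (Suc k) (d + 1)
      * (if 0 < d then diag_prod v (Suc (Suc k)) (d - 1) else diag_prod v (Suc k) 1)"
    unfolding IH * by (cases d) auto
  finally show ?case .
qed

lemma diag_prod_add_box:
  assumes S': "shifted_shape (insert (p, p + d) S)" "(p, p + d) \<notin> S"
    and pos: "\<And>x. x \<in> insert (p, p + d) S \<Longrightarrow> v x > 0"
  shows "diag_prod (add_box p (p + d) v) p d * diag_prod v (p - 1) d
    = v (p, p + d) * diag_prod v (p - 1) (d + 1) * (if 0 < d then diag_prod v p (d - 1) else diag_prod v (p - 1) 1)"
proof -
  note * = shifted_shapeD(3)[OF S'(1) insertI1]
  have p: "1 \<le> p" using shifted_shapeD[OF S'(1) insertI1] by auto
  then obtain k where k: "p = Suc k" by (cases p) auto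
  have vpos: "v (a, b) > 0" if "1 \<le> a" "a \<le> p" "a \<le> b" "b \<le> p + d" for a b
    using that by (intro pos *) auto
  have "diag_prod (add_box p (p + d) v) k d = (\<Prod>i = 1..k. inflow v i (i + d) / outflow v i (i + d) / v (i, i + d))"
    unfolding diag_prod_def using p k by (intro prod.cong) (auto simp: add_box_apply)
  then have "diag_prod (add_box p (p + d) v) k d * diag_prod v k d
      = (\<Prod>i = 1..k. inflow v i (i + d) / outflow v i (i + d) / v (i, i + d) * v (i, i + d))"
    by (simp only: diag_prod_def prod.distrib)
  also have "\<dots> = (\<Prod>i = 1..k. inflow v i (i + d) / outflow v i (i + d))"
    using k by (intro prod.cong refl nonzero_divide_eq_eq[THEN iffD1, symmetric])
      (auto intro!: less_imp_neq[THEN not_sym] vpos)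
  finally have "diag_prod (add_box p (p + d) v) p d * diag_prod v (p - 1) d
      = v (p, p + d) * ((\<Prod>i = 1..k. inflow v i (i + d) / outflow v i (i + d)) * inflow v (Suc k) (Suc k + d))"
    using k p by (simp add: add_box_apply mult_ac)
  also have "(\<Prod>i = 1..k. inflow v i (i + d) / outflow v i (i + d)) * inflow v (Suc k) (Suc k + d)
      = diag_prod v k (d + 1) * (if 0 < d then diag_prod v (Suc k) (d - 1) else diag_prod v k 1)"
    by (rule prod_inflow_div_outflow) (use k in \<open>auto intro!: vpos\<close>)
  finally show ?thesis using k by (simp add: mult.assoc)
qed

lemma alternating_diag_add_box:
  assumes S': "shifted_shape (insert (p, p) S)" "(p, p) \<notin> S"
    and pos: "\<And>x. x \<in> insert (p, p) S \<Longrightarrow> v x > 0"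
  shows "alternating_diag (add_box p p v) p = v (p, p) * alternating_diag v (p - 1)"
proof -
  note * = shifted_shapeD(3)[OF S'(1) insertI1]
  have p: "1 \<le> p" using shifted_shapeD[OF S'(1) insertI1] by auto
  have vpos: "v (a, b) > 0" if "1 \<le> a" "a \<le> b" "b \<le> p" for a b
    using that by (intro pos *) auto
  have altpos: "alternating_diag v k > 0" if "k < p" for k
    using that by (induction k) (auto intro!: divide_pos_pos vpos)
  have below: "alternating_diag (add_box p p v) k = (if k = 0 then 1 else v (k, Suc k) / alternating_diag v k)"
    if "k < p" for k
    using that
  proof (induction k)
    case (Suc k)
    have "v (Suc k, Suc (Suc k)) > 0" "v (Suc k, Suc k) > 0" "0 < k \<Longrightarrow> v (k, Suc k) > 0"
      using Suc.prems by (auto intro!: vpos)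
    then have "(if k = 0 then 1 else v (k, Suc k)) * v (Suc k, Suc (Suc k)) / v (Suc k, Suc k)
          / (if k = 0 then 1 else v (k, Suc k) / alternating_diag v k)
        = v (Suc k, Suc (Suc k)) / (v (Suc k, Suc k) / alternating_diag v k)"
      using altpos[of k] Suc.prems by (cases "k = 0") (auto simp: field_simps)
    moreover have "add_box p p v (Suc k, Suc k)
        = (if k = 0 then 1 else v (k, Suc k)) * v (Suc k, Suc (Suc k)) / v (Suc k, Suc k)"
      using Suc.prems by (simp add: add_box_apply inflow_def outflow_def)
    moreover have "alternating_diag (add_box p p v) k = (if k = 0 then 1 else v (k, Suc k) / alternating_diag v k)"
      using Suc by simp
    ultimately show ?case
      by (simp only: alternating_diag.simps nat.distinct if_False)
  qed simp
  obtain k where k: "p = Suc k" using p by (cases p) auto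
  have "0 < k \<Longrightarrow> v (k, Suc k) > 0"  using k by (auto intro!: vpos)
  then show ?thesis
    using k below[of k] altpos[of k] p by (auto simp: add_box_apply inflow_def)
qed

definition border_box :: "(nat \<times> nat) set \<Rightarrow> nat \<Rightarrow> nat \<Rightarrow> bool" where
  "border_box S i j \<longleftrightarrow> (i, j) \<in> S \<and> (i + 1, j + 1) \<notin> S"

definition rsk_image :: "(nat \<times> nat) set \<Rightarrow> (nat \<times> nat) set \<Rightarrow> (nat \<times> nat \<Rightarrow> real) \<Rightarrow> (nat \<times> nat \<Rightarrow> real) \<Rightarrow> bool" where
  "rsk_image I S w v \<longleftrightarrow> (\<forall>x\<in>I. v x > 0) \<and> (\<forall>x. x \<notin> S \<longrightarrow> v x = w x) \<and>
     energy S v = (\<Sum>x\<in>S. 1 / w x) \<and>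
     (\<forall>i j. border_box S i j \<longrightarrow> v (i, j) = path_sum w i j \<and> diag_prod v i (j - i) = sym_rect_prod w i j) \<and>
     (\<forall>p. border_box S p p \<longrightarrow> alternating_diag v p = (\<Prod>i = 1..p. w (i, i)))"

lemma rsk_image_add_box:
  assumes I: "insert (p, q) S \<subseteq> I" "finite I" and S: "shifted_shape S"
    and S': "shifted_shape (insert (p, q) S)" "(p, q) \<notin> S"
    and w: "\<And>x. x \<in> I \<Longrightarrow> w x > 0" and inv: "rsk_image I S w v"
  shows "rsk_image I (insert (p, q) S) w (add_box p q v)"
proof -
  let ?v = "add_box p q v" and ?S = "insert (p, q) S"
  note * = shifted_shapeD(3)[OF S'(1) insertI1]
  have pq: "1 \<le> p" "p \<le> q" using shifted_shapeD[OF S'(1) insertI1] by auto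
  have fin: "finite S" using I finite_subset by auto
  have pos: "\<And>x. x \<in> I \<Longrightarrow> v x > 0" and out: "\<And>x. x \<notin> S \<Longrightarrow> v x = w x"
    and en: "energy S v = (\<Sum>x\<in>S. 1 / w x)"
    and path: "\<And>i j. border_box S i j \<Longrightarrow> v (i, j) = path_sum w i j"
    and diag: "\<And>i j. border_box S i j \<Longrightarrow> diag_prod v i (j - i) = sym_rect_prod w i j"
    and alt: "\<And>p. border_box S p p \<Longrightarrow> alternating_diag v p = (\<Prod>i = 1..p. w (i, i))"
    using inv unfolding rsk_image_def by auto
  have pos': "v x > 0" if "x \<in> ?S" for x using pos[of x] I that by blast
  have corner: "(i, j) \<notin> S" if "p \<le> i" "q \<le> j" for i j
    using shifted_shapeD(3)[OF S, of i j p q] S'(2) pq that by auto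
  have mem: "(i, j) \<in> S" if "1 \<le> i" "i \<le> j" "i \<le> p" "j \<le> q" "i < p \<or> j < q" for i j
    using *[of i j] that by auto
  have wpq: "v (p, q) = w (p, q)" using out S'(2) by auto
  have bup: "border_box S (p - 1) q" if "1 < p"
    using that pq corner[of p "q + 1"] by (auto simp: border_box_def intro!: mem)
  have bleft: "border_box S p (q - 1)" if "p < q"
    using that pq corner[of "p + 1" q] by (auto simp: border_box_def intro!: mem)
  have bcorner: "border_box S (p - 1) (q - 1)" if "1 < p"
    using that pq S'(2) by (auto simp: border_box_def intro!: mem)
  have new: "border_box ?S i j \<Longrightarrow> (i, j) = (p, q) \<or> (border_box S i j \<and> j \<noteq> i + (q - p))" for i j
  proof -
    assume b: "border_box ?S i j"
    show ?thesis
    proof (cases "(i, j) = (p, q)")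
      case False
      then have ij: "(i, j) \<in> S" "(i + 1, j + 1) \<notin> S" "(i + 1, j + 1) \<noteq> (p, q)"
        using b by (auto simp: border_box_def)
      have "j \<noteq> i + (q - p)"
      proof
        assume j: "j = i + (q - p)"
        have "i < p" using corner[of i j] ij j pq by (cases "i < p") auto
        moreover have "1 \<le> i" using shifted_shapeD[OF S ij(1)] by auto
        ultimately have "(i + 1, j + 1) \<in> ?S" using j pq by (intro *) auto
        then show False using ij by auto
      qed
      then show ?thesis using ij by (auto simp: border_box_def)
    qed auto
  qed
  have pos_new: "?v x > 0" if x: "x \<in> I" for x
  proof -
    obtain i j where ij: "x = (i, j)" by (cases x)
    consider "i = p" "j = q" | "1 \<le> i" "i < p" "j = i + (q - p)" | "?v (i, j) = v (i, j)"
      using add_box_apply[OF pq, of v i j] by metis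
    then show ?thesis
    proof cases
      case 1
      then show ?thesis using pq ij inflow_pos[OF S'(1) insertI1 pos'] pos[OF x] by (simp add: add_box_apply)
    next
      case 2
      have "(i, j) \<in> S" "(i, j + 1) \<in> S" by (rule mem; use 2 pq in linarith)+
      moreover have "(i + 1, j) \<in> S" if "i < j" by (rule mem; use 2 pq that in linarith)
      ultimately have "inflow v i j > 0" "outflow v i j > 0"
        using inflow_pos[OF S'(1) _ pos', of i j] pos' by (auto intro!: outflow_pos)
      then show ?thesis using 2 pq ij pos[OF x] by (simp add: add_box_apply)
    next
      case 3 then show ?thesis using pos[OF x] ij by simp
    qed
  qed
  have unchanged: "?v (i, j) = v (i, j)" if "j \<noteq> i + (q - p)" for i j
    using that pq by (auto simp: add_box_apply)
  have 1: "?v x = w x" if "x \<notin> ?S" for x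
  proof -
    obtain i j where ij: "x = (i, j)" by (cases x)
    have "\<not> (1 \<le> i \<and> i < p \<and> j = i + (q - p))"
      using that ij mem[of i j] pq by fastforce
    then have "?v (i, j) = v (i, j)"
      using that ij pq add_box_apply[OF pq, of v i j] by auto
    then show ?thesis using that out ij by auto
  qed
  have 2: "energy ?S ?v = (\<Sum>x\<in>?S. 1 / w x)"
    using energy_add_box[OF S fin S' pos'] en wpq S'(2) fin by simp
  have 3: "?v (i, j) = path_sum w i j \<and> diag_prod ?v i (j - i) = sym_rect_prod w i j"
    if b: "border_box ?S i j" for i j
    using new[OF b]
  proof
    assume "(i, j) = (p, q)"
    then have ij: "i = p" "j = q" by auto
    have "inflow v p q = inflow (\<lambda>(i, j). path_sum w i j) p q"
      using bup bleft path unfolding inflow_def by auto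
    then have "?v (p, q) = path_sum w p q"
      using pq wpq by (simp add: add_box_apply path_sum_inflow)
    moreover have "diag_prod ?v p (q - p) = sym_rect_prod w p q"
    proof -
      define d where "d = q - p"
      have q: "q = p + d" using pq d_def by simp
      obtain k where k: "p = Suc k" using pq by (cases p) auto
      have A: "diag_prod v k d = sym_rect_prod w k (k + d)"
        using diag[OF bcorner] k q by (cases "k = 0") auto
      have B: "diag_prod v k (d + 1) = sym_rect_prod w k (Suc k + d)"
        using diag[OF bup] k q by (cases "k = 0") (auto simp: Suc_diff_le)
      have C: "0 < d \<Longrightarrow> diag_prod v p (d - 1) = sym_rect_prod w (Suc k) (k + d)"
        using diag[OF bleft] k q by auto
      have D: "(if 0 < d then diag_prod v p (d - 1) else diag_prod v k 1) = sym_rect_prod w (Suc k) (k + d)"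
        using B C by (auto simp: sym_rect_prod_commute[of w k])
      have nz: "sym_rect_prod w k (k + d) \<noteq> 0"
      proof -
        have "v (a, a + d) > 0" if "a \<in> {1..k}" for a
          using that k q by (intro pos' insertI2 mem) auto
        then show ?thesis unfolding A[symmetric] diag_prod_def by (force simp: prod_zero_iff)
      qed
      have "diag_prod ?v p d * sym_rect_prod w k (k + d)
          = w (p, q) * sym_rect_prod w k (Suc k + d) * sym_rect_prod w (Suc k) (k + d)"
      proof -
        have "p - 1 = k" using k by simp
        have "diag_prod ?v p d * diag_prod v (p - 1) d = v (p, q) * diag_prod v (p - 1) (d + 1)
            * (if 0 < d then diag_prod v p (d - 1) else diag_prod v (p - 1) 1)"
          unfolding q by (rule diag_prod_add_box[where S = S]) (use S' pos' q in auto)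
        then show ?thesis unfolding \<open>p - 1 = k\<close> A B D wpq .
      qed
      also have "\<dots> = sym_rect_prod w (Suc k) (Suc k + d) * sym_rect_prod w k (k + d)"
        using sym_rect_prod_Suc[of w k "k + d"] k q by (simp add: min_def max_def)
      finally have "diag_prod ?v p d = sym_rect_prod w (Suc k) (Suc k + d)" using nz by simp
      then show ?thesis unfolding d_def[symmetric] k[symmetric] q[symmetric] .
    qed
    ultimately show ?thesis using ij by simp
  next
    assume b': "border_box S i j \<and> j \<noteq> i + (q - p)"
    then have "i \<le> j" using shifted_shapeD[OF S, of i j] by (auto simp: border_box_def)
    then have "diag_prod ?v i (j - i) = diag_prod v i (j - i)"
      unfolding diag_prod_def using b' by (intro prod.cong refl unchanged) auto
    then show ?thesis using path diag b' unchanged by auto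
  qed
  have 4: "alternating_diag ?v k = (\<Prod>i = 1..k. w (i, i))" if b: "border_box ?S k k" for k
    using new[OF b]
  proof
    assume k: "(k, k) = (p, q)"
    then have kp: "k = p" "q = p" by auto
    have "alternating_diag ?v p = w (p, p) * alternating_diag v (p - 1)"
      using alternating_diag_add_box[of p S v] S' pos' wpq kp by auto
    moreover have "alternating_diag v (p - 1) = (\<Prod>i = 1..p - 1. w (i, i))"
      using alt[of "p - 1"] bcorner kp pq by (cases "p = 1") auto
    ultimately show ?thesis using kp pq by (cases p) auto
  next
    assume b': "border_box S k k \<and> k \<noteq> k + (q - p)"
    have "alternating_diag ?v l = alternating_diag v l" for l
      using b' by (induction l) (auto simp: unchanged)
    then show ?thesis using alt b' by auto
  qed
  show ?thesis
    unfolding rsk_image_def using pos_new 1 2 3 4 by blast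
qed

theorem rsk_exists:
  assumes "finite I" "shifted_shape S" "S \<subseteq> I"
  shows "\<exists>\<Phi>. haar_preserving I \<Phi> \<and> (\<forall>w. (\<forall>x\<in>I. w x > 0) \<longrightarrow> rsk_image I S w (\<Phi> w))"
  using finite_subset[OF assms(3,1)] assms(2,3)
proof (induction "card S" arbitrary: S)
  case 0
  then have "S = {}" by auto
  then have "rsk_image I S w w" if "\<forall>x\<in>I. w x > 0" for w
    using that by (auto simp: rsk_image_def energy_def border_box_def)
  then show ?case using haar_preserving_id[of I] by auto
next
  case (Suc c)
  then have ne: "S \<noteq> {}" by auto
  have "Max ((\<lambda>y. fst y + snd y) ` S) \<in> (\<lambda>y. fst y + snd y) ` S"
    using ne Suc.prems(1) by (intro Max_in) auto
  then obtain x where x: "x \<in> S" "fst x + snd x = Max ((\<lambda>y. fst y + snd y) ` S)" by auto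
  have x_max: "fst y + snd y \<le> fst x + snd x" if "y \<in> S" for y
    unfolding x(2) using that Suc.prems(1) by (intro Max_ge) auto
  obtain p q where pq: "x = (p, q)" by (cases x)
  have c: "(i, j) = (p, q)" if "(i, j) \<in> S" "p \<le> i" "q \<le> j" for i j
    using x_max[OF that(1)] that pq by auto
  define S0 where "S0 = S - {(p, q)}"
  have S0: "shifted_shape S0" unfolding S0_def by (rule shifted_shape_remove_corner[OF Suc.prems(2) c])
  have S: "S = insert (p, q) S0" "(p, q) \<notin> S0" using x pq by (auto simp: S0_def)
  have "c = card S0" using Suc.hyps(2) Suc.prems(1) x pq by (auto simp: S0_def)
  then obtain \<Phi> where \<Phi>: "haar_preserving I \<Phi>" "\<And>w. (\<forall>x\<in>I. w x > 0) \<Longrightarrow> rsk_image I S0 w (\<Phi> w)"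
    using Suc.hyps(1)[of S0] S0 Suc.prems S0_def by blast
  have "haar_preserving I (\<lambda>v. add_box p q (\<Phi> v))"
    by (rule haar_preserving_comp[OF \<Phi>(1) haar_preserving_add_box[OF assms(1) Suc.prems(3,2)]])
      (use x(1) pq in auto)
  moreover have "rsk_image I S w (add_box p q (\<Phi> w))" if "\<forall>x\<in>I. w x > 0" for w
    unfolding S(1)
  proof (rule rsk_image_add_box[OF _ assms(1) S0 _ S(2) _ \<Phi>(2)[OF that]])
    show "insert (p, q) S0 \<subseteq> I" "shifted_shape (insert (p, q) S0)"
      using Suc.prems unfolding S(1) by auto
  qed (use that in auto)
  ultimately show ?case by blast
qed

subsection \<open>Path sums and independent inverse-gamma weights\<close>

definition trap_paths :: "nat \<Rightarrow> nat \<Rightarrow> nat \<Rightarrow> nat \<Rightarrow> (nat \<times> nat) list set" where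
  "trap_paths n m p q = {\<pi>. up_right_path \<pi> (1, 1) (p, q) \<and> set \<pi> \<subseteq> trap_index n m}"

lemma up_right_path_single [simp]: "up_right_path [x] s e \<longleftrightarrow> x = s \<and> x = e"
  by (auto simp: up_right_path_def)

lemma up_right_path_snoc:
  assumes "\<pi> \<noteq> []"
  shows "up_right_path (\<pi> @ [x]) s e \<longleftrightarrow> x = e \<and> up_right_path \<pi> s (last \<pi>) \<and>
    (e = (fst (last \<pi>) + 1, snd (last \<pi>)) \<or> e = (fst (last \<pi>), snd (last \<pi>) + 1))"
proof -
  let ?st = "\<lambda>\<pi> k. \<pi> ! (k + 1) = (fst (\<pi> ! k) + 1, snd (\<pi> ! k)) \<or> \<pi> ! (k + 1) = (fst (\<pi> ! k), snd (\<pi> ! k) + 1)"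
  obtain l where l: "length \<pi> = Suc l" using assms by (cases \<pi>) auto
  have "(\<forall>k < length (\<pi> @ [x]) - 1. ?st (\<pi> @ [x]) k)
      \<longleftrightarrow> (\<forall>k < l. ?st (\<pi> @ [x]) k) \<and> ?st (\<pi> @ [x]) l"
    using l by (auto simp: less_Suc_eq)
  also have "(\<forall>k < l. ?st (\<pi> @ [x]) k) \<longleftrightarrow> (\<forall>k < length \<pi> - 1. ?st \<pi> k)"
    using l by (auto simp: nth_append)
  also have "?st (\<pi> @ [x]) l \<longleftrightarrow> x = (fst (last \<pi>) + 1, snd (last \<pi>)) \<or> x = (fst (last \<pi>), snd (last \<pi>) + 1)"
    using l assms by (simp add: nth_append last_conv_nth)
  finally show ?thesis
    using assms unfolding up_right_path_def by (simp add: hd_append) blast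
qed

lemma trap_paths_empty: "(p, q) \<notin> trap_index n m \<Longrightarrow> trap_paths n m p q = {}"
  by (auto simp: trap_paths_def up_right_path_def dest!: last_in_set)

lemma trap_paths_origin:
  assumes "(1, 1) \<in> trap_index n m"
  shows "trap_paths n m 1 1 = {[(1, 1)]}"
proof -
  have "\<pi> = [(1, 1)]" if "\<pi> \<in> trap_paths n m 1 1" for \<pi>
  proof (cases \<pi> rule: rev_cases)
    case Nil
    then show ?thesis using that by (simp add: trap_paths_def up_right_path_def)
  next
    case (snoc ys y)
    show ?thesis
    proof (cases "ys = []")
      case False
      then have "last ys \<in> trap_index n m" using that snoc by (auto simp: trap_paths_def)
      then show ?thesis using that snoc False
        by (cases "last ys") (auto simp: trap_paths_def up_right_path_snoc trap_index_def)
    qed (use that snoc in \<open>auto simp: trap_paths_def\<close>)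
  qed
  then show ?thesis using assms by (auto simp: trap_paths_def)
qed

lemma trap_paths_step:
  assumes I: "(p, q) \<in> trap_index n m" and "(p, q) \<noteq> (1, 1)"
  shows "trap_paths n m p q = (\<lambda>\<pi>. \<pi> @ [(p, q)]) ` (trap_paths n m (p - 1) q \<union> trap_paths n m p (q - 1))"
    (is "_ = ?R")
proof (intro set_eqI iffI)
  fix \<pi> assume \<pi>: "\<pi> \<in> trap_paths n m p q"
  show "\<pi> \<in> ?R"
  proof (cases \<pi> rule: rev_cases)
    case Nil
    then show ?thesis using \<pi> by (simp add: trap_paths_def up_right_path_def)
  next
    case (snoc ys y)
    have ne: "ys \<noteq> []" using \<pi> snoc assms by (auto simp: trap_paths_def)
    obtain a b where ab: "last ys = (a, b)" by (cases "last ys")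
    have "y = (p, q)" "up_right_path ys (1, 1) (a, b)" "(p, q) = (a + 1, b) \<or> (p, q) = (a, b + 1)"
      "set ys \<subseteq> trap_index n m"
      using \<pi> snoc ab by (auto simp: trap_paths_def up_right_path_snoc[OF ne])
    then show ?thesis using snoc by (auto simp: trap_paths_def)
  qed
next
  fix \<pi> assume "\<pi> \<in> ?R"
  then obtain ys where ys: "\<pi> = ys @ [(p, q)]" "ys \<in> trap_paths n m (p - 1) q \<or> ys \<in> trap_paths n m p (q - 1)"
    by auto
  have ne: "ys \<noteq> []" using ys by (auto simp: trap_paths_def up_right_path_def)
  have lst: "last ys \<in> trap_index n m" using ys ne by (auto simp: trap_paths_def)
  have "last ys = (p - 1, q) \<or> last ys = (p, q - 1)"
    using ys by (auto simp: trap_paths_def up_right_path_def)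
  moreover have "up_right_path ys (1, 1) (last ys)"
    using ys by (auto simp: trap_paths_def up_right_path_def)
  ultimately show "\<pi> \<in> trap_paths n m p q"
    using ys I lst unfolding trap_paths_def by (auto simp: up_right_path_snoc[OF ne] trap_index_def)
qed

lemma sum_trap_paths:
  "finite (trap_paths n m p q) \<and>
   ((p, q) \<in> trap_index n m \<longrightarrow> (\<Sum>\<pi>\<in>trap_paths n m p q. prod_list (map w \<pi>)) = path_sum w p q)"
proof (induction "p + q" arbitrary: p q rule: less_induct)
  case less
  consider "(p, q) \<notin> trap_index n m" | "(p, q) \<in> trap_index n m" "(p, q) = (1, 1)"
    | "(p, q) \<in> trap_index n m" "(p, q) \<noteq> (1, 1)" by blast
  then show ?case
  proof cases
    case 1
    then show ?thesis by (simp add: trap_paths_empty)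
  next
    case 2
    then show ?thesis using trap_paths_origin[of n m] by auto
  next
    case 3
    then have pq: "1 \<le> p" "p \<le> q" by (auto simp: trap_index_def)
    let ?A = "trap_paths n m (p - 1) q" and ?B = "trap_paths n m p (q - 1)"
    let ?f = "\<lambda>\<pi>. \<pi> @ [(p, q)]"
    have fin: "finite ?A" "finite ?B" using less[of "p - 1" q] less[of p "q - 1"] pq by auto
    have A: "(\<Sum>\<pi>\<in>?A. prod_list (map w \<pi>)) = path_sum w (p - 1) q"
    proof (cases "(p - 1, q) \<in> trap_index n m")
      case False
      then have "p = 1" using 3 by (auto simp: trap_index_def)
      then show ?thesis using False by (simp add: trap_paths_empty)
    qed (use less[of "p - 1" q] pq in auto)
    have B: "(\<Sum>\<pi>\<in>?B. prod_list (map w \<pi>)) = path_sum w p (q - 1)"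
    proof (cases "(p, q - 1) \<in> trap_index n m")
      case False
      then have "p = q" using 3 by (auto simp: trap_index_def)
      then show ?thesis using False pq by (simp add: trap_paths_empty)
    qed (use less[of p "q - 1"] pq in auto)
    have disj: "?A \<inter> ?B = {}" using pq by (auto simp: trap_paths_def up_right_path_def)
    have "(\<Sum>\<pi>\<in>trap_paths n m p q. prod_list (map w \<pi>)) = (\<Sum>\<pi>\<in>?A \<union> ?B. prod_list (map w (?f \<pi>)))"
      unfolding trap_paths_step[OF 3] by (subst sum.reindex) (auto simp: inj_on_def)
    also have "\<dots> = (\<Sum>\<pi>\<in>?A \<union> ?B. prod_list (map w \<pi>)) * w (p, q)"
      by (simp add: sum_distrib_right)
    also have "\<dots> = (path_sum w (p - 1) q + path_sum w p (q - 1)) * w (p, q)"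
      unfolding sum.union_disjoint[OF fin disj] A B ..
    also have "\<dots> = path_sum w p q"
      using 3 pq path_sum_step[of p q w] by auto
    finally show ?thesis unfolding trap_paths_step[OF 3] using fin by simp
  qed
qed

lemma Z_trap_eq_path_sum:
  "Z_trap n m W \<omega> = (\<Sum>k = 1..n. path_sum (\<lambda>q. W q \<omega>) k (2 * n + m + 1 - k))"
  unfolding Z_trap_def trap_paths_def[symmetric]
  by (intro sum.cong refl sum_trap_paths[THEN conjunct2, rule_format]) (auto simp: trap_index_def)

lemma path_sum_cong:
  assumes "\<And>a b. 1 \<le> a \<Longrightarrow> a \<le> b \<Longrightarrow> a \<le> i \<Longrightarrow> b \<le> j \<Longrightarrow> v (a, b) = w (a, b)"
  shows "path_sum v i j = path_sum w i j"
  using assms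
proof (induction v i j rule: path_sum.induct)
  case (1 v i j)
  show ?case
  proof (cases "i = 0 \<or> j < i \<or> (i = 1 \<and> j = 1)")
    case True
    then show ?thesis using "1.prems"[of 1 1] by auto
  next
    case False
    then have "path_sum v (i - 1) j = path_sum w (i - 1) j" "path_sum v i (j - 1) = path_sum w i (j - 1)"
      using 1 by auto
    moreover have "v (i, j) = w (i, j)" using False by (intro "1.prems") auto
    ultimately show ?thesis using False path_sum_step[of i j] by simp
  qed
qed

lemma path_sum_nonneg:
  assumes "\<And>a b. 1 \<le> a \<Longrightarrow> a \<le> b \<Longrightarrow> a \<le> i \<Longrightarrow> b \<le> j \<Longrightarrow> w (a, b) \<ge> 0"
  shows "path_sum w i j \<ge> 0"
  using assms
proof (induction w i j rule: path_sum.induct)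
  case (1 w i j)
  show ?case
  proof (cases "i = 0 \<or> j < i \<or> (i = 1 \<and> j = 1)")
    case True
    then show ?thesis using "1.prems"[of 1 1] by auto
  next
    case False
    then have "path_sum w (i - 1) j \<ge> 0" "path_sum w i (j - 1) \<ge> 0"
      using 1 by auto
    moreover have "w (i, j) \<ge> 0" using False by (intro "1.prems") auto
    ultimately show ?thesis using False path_sum_step[of i j] by simp
  qed
qed

lemma path_sum_measurable [measurable]:
  "(\<lambda>v. path_sum v i j) \<in> borel_measurable (haar_prod I)"
proof (induction "i + j" arbitrary: i j rule: less_induct)
  case less
  show ?case
  proof (cases "i = 0 \<or> j < i \<or> (i = 1 \<and> j = 1)")
    case True
    then show ?thesis by auto
  next
    case False
    then have "(\<lambda>v. path_sum v (i - 1) j) \<in> borel_measurable (haar_prod I)"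
      "(\<lambda>v. path_sum v i (j - 1)) \<in> borel_measurable (haar_prod I)"
      using less[of "i - 1" j] less[of i "j - 1"] by auto
    then show ?thesis using False path_sum_step[of i j] by simp
  qed
qed

lemma PiM_density_haar:
  fixes f :: "'i \<Rightarrow> real \<Rightarrow> real"
  assumes "finite I" and f[measurable]: "\<And>i. f i \<in> borel_measurable borel"
  shows "PiM I (\<lambda>i. density haar_pos (\<lambda>x. ennreal (f i x)))
    = density (haar_prod I) (\<lambda>v. \<Prod>i\<in>I. ennreal (f i (v i)))"
proof -
  have fm: "(\<lambda>x. ennreal (f i x)) \<in> borel_measurable haar_pos" for i
    using f[of i] by (subst measurable_cong_sets[OF sets_haar_pos refl]) measurable
  interpret D: product_sigma_finite "\<lambda>i. density haar_pos (\<lambda>x. ennreal (f i x))"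
    unfolding product_sigma_finite_def
    by (intro allI sigma_finite_measure.sigma_finite_iff_density_finite[OF sigma_finite_haar_pos, THEN iffD2])
       (use fm in auto)
  have sets_eq: "sets (PiM I (\<lambda>i. density haar_pos (\<lambda>x. ennreal (f i x)))) = sets (haar_prod I)"
    by (intro sets_PiM_cong) auto
  have [measurable]: "(\<lambda>v. ennreal (f i (v i))) \<in> borel_measurable (haar_prod I)" for i
    by measurable
  show ?thesis
  proof (rule D.PiM_eqI[symmetric, OF \<open>finite I\<close>])
    show "sets (density (haar_prod I) (\<lambda>v. \<Prod>i\<in>I. ennreal (f i (v i))))
        = sets (PiM I (\<lambda>i. density haar_pos (\<lambda>x. ennreal (f i x))))"
      using sets_eq by simp
    fix A assume "\<And>i. i \<in> I \<Longrightarrow> A i \<in> sets (density haar_pos (\<lambda>x. ennreal (f i x)))"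
    then have A: "\<And>i. i \<in> I \<Longrightarrow> A i \<in> sets borel" by simp
    have "emeasure (density (haar_prod I) (\<lambda>v. \<Prod>i\<in>I. ennreal (f i (v i)))) (Pi\<^sub>E I A)
      = (\<integral>\<^sup>+ v. (\<Prod>i\<in>I. ennreal (f i (v i))) * indicator (Pi\<^sub>E I A) v \<partial>haar_prod I)"
      using A \<open>finite I\<close> by (intro emeasure_density) (auto intro!: sets_PiM_I_finite)
    also have "\<dots> = (\<integral>\<^sup>+ v. (\<Prod>i\<in>I. ennreal (f i (v i)) * indicator (A i) (v i)) \<partial>haar_prod I)"
    proof (intro nn_integral_cong)
      fix v assume v: "v \<in> space (haar_prod I)"
      have "indicator (Pi\<^sub>E I A) v = (\<Prod>i\<in>I. indicator (A i) (v i) :: ennreal)"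
        using v \<open>finite I\<close> by (auto simp: indicator_def space_PiM PiE_iff prod_zero_iff intro!: prod.neutral)
      then show "(\<Prod>i\<in>I. ennreal (f i (v i))) * indicator (Pi\<^sub>E I A) v
          = (\<Prod>i\<in>I. ennreal (f i (v i)) * indicator (A i) (v i))"
        by (simp add: prod.distrib)
    qed
    also have "\<dots> = (\<Prod>i\<in>I. \<integral>\<^sup>+ x. ennreal (f i x) * indicator (A i) x \<partial>haar_pos)"
      using A fm \<open>finite I\<close> by (intro haar.product_nn_integral_prod borel_measurable_times_ennreal borel_measurable_indicator) auto
    also have "\<dots> = (\<Prod>i\<in>I. emeasure (density haar_pos (\<lambda>x. ennreal (f i x))) (A i))"
      using A fm by (intro prod.cong refl emeasure_density[symmetric]) auto
    finally show "emeasure (density (haar_prod I) (\<lambda>v. \<Prod>i\<in>I. ennreal (f i (v i)))) (Pi\<^sub>E I A)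
      = (\<Prod>i\<in>I. emeasure (density haar_pos (\<lambda>x. ennreal (f i x))) (A i))" .
  qed
qed

lemma inv_gamma_measure_density_haar:
  assumes "\<theta> > 0"
  shows "inv_gamma_measure \<theta> = density haar_pos (\<lambda>x. ennreal (x powr (- \<theta>) * exp (- 1 / x) / Gamma \<theta>))"
proof -
  have "Gamma \<theta> > 0" using assms by (rule Gamma_real_pos)
  then have "ennreal (if x > 0 then x powr (- \<theta> - 1) * exp (- 1 / x) / Gamma \<theta> else 0)
      = ennreal (if x > 0 then 1 / x else 0) * ennreal (x powr (- \<theta>) * exp (- 1 / x) / Gamma \<theta>)" for x
    by (auto simp: powr_diff field_simps simp flip: ennreal_mult')
  then show ?thesis
    unfolding inv_gamma_measure_def haar_pos_def by (subst density_density_eq) auto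
qed

lemma (in prob_space) nn_integral_indep_inv_gamma:
  assumes "finite I" "I \<noteq> {}" and indep: "indep_vars (\<lambda>_. borel) W I"
    and dist: "\<And>q. q \<in> I \<Longrightarrow> distr M lborel (W q) = inv_gamma_measure (\<theta> q)"
    and \<theta>: "\<And>q. q \<in> I \<Longrightarrow> \<theta> q > 0"
    and g[measurable]: "g \<in> borel_measurable (haar_prod I)"
  shows "(\<integral>\<^sup>+ \<omega>. g (\<lambda>q\<in>I. W q \<omega>) \<partial>M) = (\<integral>\<^sup>+ v. (\<Prod>q\<in>I.
     ennreal (v q powr (- \<theta> q) * exp (- 1 / v q) / Gamma (\<theta> q))) * g v \<partial>haar_prod I)"
proof -
  have rv: "\<And>q. q \<in> I \<Longrightarrow> random_variable borel (W q)"
    using indep by (auto simp: indep_vars_def)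
  have gb: "g \<in> borel_measurable (PiM I (\<lambda>_. borel))"
    using g by (subst measurable_cong_sets[OF sets_PiM_cong[OF refl, of _ _ "\<lambda>_. haar_pos"] refl]) auto
  have X: "(\<lambda>\<omega>. \<lambda>q\<in>I. W q \<omega>) \<in> measurable M (PiM I (\<lambda>_. borel))"
    using rv by (intro measurable_restrict) auto
  have "(\<integral>\<^sup>+ \<omega>. g (\<lambda>q\<in>I. W q \<omega>) \<partial>M) = (\<integral>\<^sup>+ v. g v \<partial>distr M (PiM I (\<lambda>_. borel)) (\<lambda>\<omega>. \<lambda>q\<in>I. W q \<omega>))"
    using gb by (intro nn_integral_distr[symmetric] X) simp
  also have "distr M (PiM I (\<lambda>_. borel)) (\<lambda>\<omega>. \<lambda>q\<in>I. W q \<omega>) = PiM I (\<lambda>q. distr M borel (W q))"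
    using indep_vars_iff_distr_eq_PiM'[OF \<open>I \<noteq> {}\<close>, of W "\<lambda>_. borel"] rv indep by auto
  also have "\<dots> = PiM I (\<lambda>q. density haar_pos (\<lambda>x. ennreal (x powr (- \<theta> q) * exp (- 1 / x) / Gamma (\<theta> q))))"
  proof (intro PiM_cong refl)
    fix q assume q: "q \<in> I"
    have "distr M borel (W q) = distr M lborel (W q)" by (intro distr_cong) auto
    then show "distr M borel (W q) = density haar_pos (\<lambda>x. ennreal (x powr (- \<theta> q) * exp (- 1 / x) / Gamma (\<theta> q)))"
      using q dist \<theta> inv_gamma_measure_density_haar by simp
  qed
  also have "\<dots> = density (haar_prod I) (\<lambda>v. \<Prod>q\<in>I. ennreal (v q powr (- \<theta> q) * exp (- 1 / v q) / Gamma (\<theta> q)))"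
    using \<open>finite I\<close> by (intro PiM_density_haar) auto
  also have "(\<integral>\<^sup>+ v. g v \<partial>\<dots>) = (\<integral>\<^sup>+ v. (\<Prod>q\<in>I.
     ennreal (v q powr (- \<theta> q) * exp (- 1 / v q) / Gamma (\<theta> q))) * g v \<partial>haar_prod I)"
    by (intro nn_integral_density) measurable
  finally show ?thesis .
qed

lemma (in prob_space) AE_inv_gamma_pos:
  assumes "random_variable borel X" "distr M lborel X = inv_gamma_measure \<theta>"
  shows "AE \<omega> in M. X \<omega> > 0"
proof -
  have "AE x in inv_gamma_measure \<theta>. x > 0"
    unfolding inv_gamma_measure_def by (subst AE_density) (auto intro!: AE_I2)
  then have "AE x in distr M lborel X. x > 0" unfolding assms(2) .
  then show ?thesis using assms by (subst (asm) AE_distr_iff) auto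
qed

subsection \<open>The two integrands as one integral over the trapezoid\<close>

lemma haar_preserving_inversion:
  assumes "finite I" "K \<subseteq> I" "r > 0"
  shows "haar_preserving I (\<lambda>v q. if q \<in> K then 1 / (r * v q) else v q)"
  using finite_subset[OF assms(2,1)] assms(2)
proof (induction K)
  case empty
  then show ?case by (simp add: haar_preserving_id)
next
  case (insert x K)
  have "haar_preserving I (\<lambda>v. v(x := (1 / r) / v x))"
    using assms insert.prems by (intro haar_preserving_invert) auto
  with insert have "haar_preserving I (\<lambda>v. (\<lambda>q. if q \<in> K then 1 / (r * v q) else v q)
      (x := (1 / r) / (if x \<in> K then 1 / (r * v x) else v x)))"
    using haar_preserving_comp[OF _ \<open>haar_preserving I (\<lambda>v. v(x := (1 / r) / v x))\<close>] by blast
  also have "(\<lambda>v. (\<lambda>q. if q \<in> K then 1 / (r * v q) else v q)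
      (x := (1 / r) / (if x \<in> K then 1 / (r * v x) else v x)))
    = (\<lambda>v q. if q \<in> insert x K then 1 / (r * v q) else v q)"
    using insert.hyps by (auto simp: fun_eq_iff)
  finally show ?case .
qed

lemma T_integrand_measurable:
  assumes [measurable]: "\<And>i. (\<lambda>\<omega>. x \<omega> i) \<in> borel_measurable N" "\<And>q. (\<lambda>\<omega>. t \<omega> q) \<in> borel_measurable N"
  shows "(\<lambda>\<omega>. T_integrand n m a0 b r (x \<omega>) (t \<omega>)) \<in> borel_measurable N"
  unfolding T_integrand_def T_ext_def Let_def by measurable

lemma Psi_integrand_measurable:
  assumes [measurable]: "\<And>i. (\<lambda>\<omega>. x \<omega> i) \<in> borel_measurable N" "\<And>q. (\<lambda>\<omega>. z \<omega> q) \<in> borel_measurable N"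
  shows "(\<lambda>\<omega>. Psi_integrand n a (x \<omega>) (z \<omega>)) \<in> borel_measurable N"
  unfolding Psi_integrand_def Psi_ext_def so_type_def Let_def by measurable

lemma T_integrand_cong:
  assumes "n \<ge> 1" and x: "\<And>i. i \<in> {1..n} \<Longrightarrow> x i = x' i" and t: "\<And>q. q \<in> T_vars n m \<Longrightarrow> t q = t' q"
  shows "T_integrand n m a0 b r x t = T_integrand n m a0 b r x' t'"
proof -
  have e: "T_ext m t x i j = T_ext m t' x' i j" if "1 \<le> i" "i \<le> n" "i \<le> j" "j \<le> i + m" for i j
    using that x t by (auto simp: T_ext_def T_vars_def)
  have "(\<Prod>i = 1..n. (r * T_ext m t x i i) powr ((-1) ^ (n - i))) = (\<Prod>i = 1..n. (r * T_ext m t' x' i i) powr ((-1) ^ (n - i)))"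
    by (intro prod.cong refl) (auto simp: e)
  moreover have "(\<Prod>j = 1..m. \<Prod>i = 1..n. (T_ext m t x i (i + j) / T_ext m t x i (i + j - 1)) powr b j)
    = (\<Prod>j = 1..m. \<Prod>i = 1..n. (T_ext m t' x' i (i + j) / T_ext m t' x' i (i + j - 1)) powr b j)"
    by (intro prod.cong refl arg_cong2[where f = "(powr)"] arg_cong2[where f = "(/)"] e) auto
  moreover have "(\<Sum>i = 2..n. \<Sum>j = i..i + m - 1. T_ext m t x i j / T_ext m t x (i - 1) j)
    = (\<Sum>i = 2..n. \<Sum>j = i..i + m - 1. T_ext m t' x' i j / T_ext m t' x' (i - 1) j)"
    by (intro sum.cong refl arg_cong2[where f = "(/)"] e) auto
  moreover have "(\<Sum>i = 1..n. \<Sum>j = i..i + m - 1. T_ext m t x i (j + 1) / T_ext m t x i j)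
    = (\<Sum>i = 1..n. \<Sum>j = i..i + m - 1. T_ext m t' x' i (j + 1) / T_ext m t' x' i j)"
    by (intro sum.cong refl arg_cong2[where f = "(/)"] e) auto
  ultimately show ?thesis
    using e[of 1 1] \<open>n \<ge> 1\<close> unfolding T_integrand_def Let_def by simp
qed

lemma Psi_integrand_cong:
  assumes x: "\<And>i. i \<in> {1..n} \<Longrightarrow> x i = x' i" and z: "\<And>q. q \<in> Psi_vars n \<Longrightarrow> z q = z' q"
  shows "Psi_integrand n a x z = Psi_integrand n a x' z'"
proof -
  have e: "Psi_ext n z x k j = Psi_ext n z' x' k j" if "1 \<le> k" "k \<le> 2 * n" "1 \<le> j" for k j
    using that x z by (auto simp: Psi_ext_def Psi_vars_def)
  have "so_type (Psi_ext n z x) k = so_type (Psi_ext n z' x') k" if "1 \<le> k" "k \<le> 2 * n" for k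
    unfolding so_type_def using that
    by (intro arg_cong2[where f = "(/)"] prod.cong refl e) auto
  then have "(\<Prod>i = 1..2 * n. so_type (Psi_ext n z x) i powr alpha_pm a i)
    = (\<Prod>i = 1..2 * n. so_type (Psi_ext n z' x') i powr alpha_pm a i)"
    by (intro prod.cong) auto
  moreover have "(\<Sum>i = 1..2 * n - 1. \<Sum>j = 1..(i + 1) div 2.
        Psi_ext n z x (i + 1) (j + 1) / Psi_ext n z x i j + Psi_ext n z x i j / Psi_ext n z x (i + 1) j)
    = (\<Sum>i = 1..2 * n - 1. \<Sum>j = 1..(i + 1) div 2.
        Psi_ext n z' x' (i + 1) (j + 1) / Psi_ext n z' x' i j + Psi_ext n z' x' i j / Psi_ext n z' x' (i + 1) j)"
    by (intro sum.cong refl arg_cong2[where f = "(+)"] arg_cong2[where f = "(/)"] e) auto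
  ultimately show ?thesis
    unfolding Psi_integrand_def Let_def by simp
qed

text \<open>The Whittaker variable \<open>z (k, l)\<close> occupies row \<open>l\<close> of the trapezoid, \<open>2 * n - k\<close> cells to the
  right of the cell \<open>(l, l + m)\<close> of \<open>x l\<close>.\<close>

definition Psi_box :: "nat \<Rightarrow> nat \<Rightarrow> nat \<times> nat \<Rightarrow> nat \<times> nat" where
  "Psi_box n m = (\<lambda>(k, l). (l, l + m + 2 * n - k))"

definition joint_integrand where
  "joint_integrand n m a0 a b r s =
     T_integrand n m a0 b r (\<lambda>i. s (i, i + m)) s * Psi_integrand n a (\<lambda>i. s (i, i + m)) (\<lambda>q. s (Psi_box n m q))"

lemma T_integrand_nonneg: "T_integrand n m a0 b r x t \<ge> 0"
  unfolding T_integrand_def Let_def by (intro mult_nonneg_nonneg prod_nonneg) auto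

lemma Psi_integrand_nonneg: "Psi_integrand n a x z \<ge> 0"
  unfolding Psi_integrand_def Let_def by (intro mult_nonneg_nonneg prod_nonneg) auto

lemma joint_integrand_measurable:
  "(\<lambda>s. joint_integrand n m a0 a b r s) \<in> borel_measurable (haar_prod I)"
  unfolding joint_integrand_def
  by (intro borel_measurable_times T_integrand_measurable Psi_integrand_measurable measurable_haar_prod_coord)

lemma finite_trap_index: "finite (trap_index n m)"
  by (rule finite_subset[of _ "{1..n} \<times> {1..2 * n + m + 1}"]) (auto simp: trap_index_def)

lemma finite_T_vars: "finite (T_vars n m)"
  by (rule finite_subset[of _ "{1..n} \<times> {1..n + m}"]) (auto simp: T_vars_def)

lemma finite_Psi_vars: "finite (Psi_vars n)"
  by (rule finite_subset[of _ "{1..2 * n} \<times> {1..2 * n}"]) (auto simp: Psi_vars_def)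

lemma inj_on_Psi_box: "inj_on (Psi_box n m) (Psi_vars n)"
  by (auto simp: inj_on_def Psi_box_def Psi_vars_def)

lemma trap_index_decomp:
  "trap_index n m = (\<lambda>i. (i, i + m)) ` {1..n} \<union> (T_vars n m \<union> Psi_box n m ` Psi_vars n)"
proof -
  have "(i, j) \<in> Psi_box n m ` Psi_vars n" if "1 \<le> i" "i \<le> n" "i + m < j" "j \<le> 2 * n + m + 1 - i" for i j
    using that by (intro image_eqI[of _ _ "(i + m + 2 * n - j, i)"]) (auto simp: Psi_box_def Psi_vars_def)
  then have "(i, j) \<in> (\<lambda>i. (i, i + m)) ` {1..n} \<union> (T_vars n m \<union> Psi_box n m ` Psi_vars n)"
    if "(i, j) \<in> trap_index n m" for i j
    using that by (cases j "i + m" rule: linorder_cases) (auto simp: trap_index_def T_vars_def)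
  moreover have "(\<lambda>i. (i, i + m)) ` {1..n} \<subseteq> trap_index n m" "T_vars n m \<subseteq> trap_index n m"
    "Psi_box n m ` Psi_vars n \<subseteq> trap_index n m"
    by (auto simp: trap_index_def T_vars_def Psi_box_def Psi_vars_def)
  ultimately show ?thesis by auto
qed

lemma T_fun_measurable: "(\<lambda>x. T_fun n m a0 b r x) \<in> borel_measurable (haar_prod {1..n})"
proof -
  interpret sigma_finite_measure "haar_prod (T_vars n m)"
    by (rule haar.sigma_finite[OF finite_T_vars])
  have "(\<lambda>(x, t). ennreal (T_integrand n m a0 b r x t))
      \<in> borel_measurable (haar_prod {1..n} \<Otimes>\<^sub>M haar_prod (T_vars n m))"
    unfolding case_prod_beta
    by (intro measurable_compose[OF _ measurable_ennreal] T_integrand_measurable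
        measurable_compose[OF measurable_fst measurable_haar_prod_coord]
        measurable_compose[OF measurable_snd measurable_haar_prod_coord])
  then show ?thesis unfolding T_fun_def by (rule borel_measurable_nn_integral)
qed

lemma Psi_so_measurable: "(\<lambda>x. Psi_so n a x) \<in> borel_measurable (haar_prod {1..n})"
proof -
  interpret sigma_finite_measure "haar_prod (Psi_vars n)"
    by (rule haar.sigma_finite[OF finite_Psi_vars])
  have "(\<lambda>(x, t). ennreal (Psi_integrand n a x t))
      \<in> borel_measurable (haar_prod {1..n} \<Otimes>\<^sub>M haar_prod (Psi_vars n))"
    unfolding case_prod_beta
    by (intro measurable_compose[OF _ measurable_ennreal] Psi_integrand_measurable
        measurable_compose[OF measurable_fst measurable_haar_prod_coord]
        measurable_compose[OF measurable_snd measurable_haar_prod_coord])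
  then show ?thesis unfolding Psi_so_def by (rule borel_measurable_nn_integral)
qed

lemma nn_integral_joint_integrand:
  assumes "n \<ge> 1"
  shows "(\<integral>\<^sup>+ s. ennreal (joint_integrand n m a0 a b r s) \<partial>haar_prod (trap_index n m))
    = (\<integral>\<^sup>+ x. T_fun n m a0 b r x * Psi_so n a x \<partial>haar_prod {1..n})"
proof -
  let ?h = "\<lambda>i. (i, i + m)"
  let ?A = "?h ` {1..n}" and ?B = "T_vars n m" and ?C = "Psi_box n m ` Psi_vars n"
  let ?G = "\<lambda>s. ennreal (joint_integrand n m a0 a b r s)"
  have disj: "?A \<inter> (?B \<union> ?C) = {}" "?B \<inter> ?C = {}"
    by (auto simp: T_vars_def Psi_box_def Psi_vars_def)
  have fin: "finite ?A" "finite ?B" "finite ?C" by (auto simp: finite_T_vars finite_Psi_vars)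
  have G: "?G \<in> borel_measurable (haar_prod J)" for J
    by (intro measurable_compose[OF joint_integrand_measurable measurable_ennreal])
  have "(\<integral>\<^sup>+ s. ?G s \<partial>haar_prod (trap_index n m))
      = (\<integral>\<^sup>+ x. (\<integral>\<^sup>+ y. ?G (merge ?A (?B \<union> ?C) (x, y)) \<partial>haar_prod (?B \<union> ?C)) \<partial>haar_prod ?A)"
    unfolding trap_index_decomp using fin G by (intro haar.product_nn_integral_fold disj) auto
  also have "\<dots> = (\<integral>\<^sup>+ x. T_fun n m a0 b r (\<lambda>i\<in>{1..n}. x (?h i)) * Psi_so n a (\<lambda>i\<in>{1..n}. x (?h i)) \<partial>haar_prod ?A)"
  proof (rule nn_integral_cong)
    fix x assume x: "x \<in> space (haar_prod ?A)"
    let ?x = "\<lambda>i\<in>{1..n}. x (?h i)"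
    let ?T = "\<lambda>t. ennreal (T_integrand n m a0 b r ?x t)"
    let ?P = "\<lambda>z. ennreal (Psi_integrand n a ?x z)"
    have split: "?G (merge ?A (?B \<union> ?C) (x, merge ?B ?C (t, z))) = ?T t * ?P (\<lambda>q\<in>Psi_vars n. z (Psi_box n m q))" for t z
    proof -
      let ?s = "merge ?A (?B \<union> ?C) (x, merge ?B ?C (t, z))"
      have sx: "?s (i, i + m) = ?x i" if "i \<in> {1..n}" for i
        using that by (auto simp: merge_def)
      have sB: "?s q = t q" if "q \<in> ?B" for q
      proof -
        have "q \<notin> ?A" using disj that by blast
        then show ?thesis using that by (simp add: merge_def)
      qed
      have sC: "?s (Psi_box n m q) = (\<lambda>q\<in>Psi_vars n. z (Psi_box n m q)) q" if "q \<in> Psi_vars n" for q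
      proof -
        have "Psi_box n m q \<notin> ?A" "Psi_box n m q \<notin> ?B" "Psi_box n m q \<in> ?C" using disj that by blast+
        then show ?thesis using that by (simp add: merge_def)
      qed
      have "T_integrand n m a0 b r (\<lambda>i. ?s (i, i + m)) ?s = T_integrand n m a0 b r ?x t"
        by (rule T_integrand_cong[OF assms sx sB])
      moreover have "Psi_integrand n a (\<lambda>i. ?s (i, i + m)) (\<lambda>q. ?s (Psi_box n m q))
          = Psi_integrand n a ?x (\<lambda>q\<in>Psi_vars n. z (Psi_box n m q))"
        by (rule Psi_integrand_cong[OF sx sC])
      ultimately show ?thesis
        by (simp add: joint_integrand_def ennreal_mult T_integrand_nonneg Psi_integrand_nonneg)
    qed
    have Tm: "?T \<in> borel_measurable (haar_prod ?B)"
      by (intro measurable_compose[OF _ measurable_ennreal] T_integrand_measurable measurable_haar_prod_coord) auto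
    have Pm: "?P \<in> borel_measurable (haar_prod J)" for J
      by (intro measurable_compose[OF _ measurable_ennreal] Psi_integrand_measurable measurable_haar_prod_coord) auto
    have Pm': "(\<lambda>z. ?P (\<lambda>q\<in>Psi_vars n. z (Psi_box n m q))) \<in> borel_measurable (haar_prod ?C)"
    proof (intro measurable_compose[OF _ measurable_ennreal] Psi_integrand_measurable)
      fix q show "(\<lambda>z. (\<lambda>q\<in>Psi_vars n. z (Psi_box n m q)) q) \<in> borel_measurable (haar_prod ?C)"
        by (cases "q \<in> Psi_vars n") auto
    qed auto
    have "(\<integral>\<^sup>+ y. ?G (merge ?A (?B \<union> ?C) (x, y)) \<partial>haar_prod (?B \<union> ?C))
      = (\<integral>\<^sup>+ t. (\<integral>\<^sup>+ z. ?G (merge ?A (?B \<union> ?C) (x, merge ?B ?C (t, z))) \<partial>haar_prod ?C) \<partial>haar_prod ?B)"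
    proof (intro haar.product_nn_integral_fold disj fin)
      have "(\<lambda>y. merge ?A (?B \<union> ?C) (x, y)) \<in> measurable (haar_prod (?B \<union> ?C)) (haar_prod (?A \<union> (?B \<union> ?C)))"
        using measurable_compose[OF measurable_Pair1'[OF x] measurable_merge] by simp
      then show "(\<lambda>y. ?G (merge ?A (?B \<union> ?C) (x, y))) \<in> borel_measurable (haar_prod (?B \<union> ?C))"
        by (rule measurable_compose[OF _ G])
    qed
    also have "\<dots> = (\<integral>\<^sup>+ t. ?T t * (\<integral>\<^sup>+ z. ?P (\<lambda>q\<in>Psi_vars n. z (Psi_box n m q)) \<partial>haar_prod ?C) \<partial>haar_prod ?B)"
      unfolding split by (intro nn_integral_cong nn_integral_cmult Pm')
    also have "\<dots> = (\<integral>\<^sup>+ t. ?T t \<partial>haar_prod ?B) * (\<integral>\<^sup>+ z. ?P (\<lambda>q\<in>Psi_vars n. z (Psi_box n m q)) \<partial>haar_prod ?C)"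
      by (intro nn_integral_multc Tm)
    also have "(\<integral>\<^sup>+ z. ?P (\<lambda>q\<in>Psi_vars n. z (Psi_box n m q)) \<partial>haar_prod ?C) = Psi_so n a ?x"
      unfolding Psi_so_def by (rule nn_integral_haar_prod_reindex[OF finite_Psi_vars inj_on_Psi_box Pm])
    finally show "(\<integral>\<^sup>+ y. ?G (merge ?A (?B \<union> ?C) (x, y)) \<partial>haar_prod (?B \<union> ?C))
      = T_fun n m a0 b r ?x * Psi_so n a ?x"
      unfolding T_fun_def .
  qed
  also have "\<dots> = (\<integral>\<^sup>+ x. T_fun n m a0 b r x * Psi_so n a x \<partial>haar_prod {1..n})"
    by (intro nn_integral_haar_prod_reindex borel_measurable_times_ennreal T_fun_measurable Psi_so_measurable)
       (auto simp: inj_on_def)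
  finally show ?thesis .
qed

subsection \<open>Matching energies and weights\<close>

context comm_monoid_set
begin

lemma triangle_swap:
  fixes n :: nat
  shows "F (\<lambda>i. F (g i) {i..n}) {1..n} = F (\<lambda>j. F (\<lambda>i. g i j) {1..j}) {1..n}"
proof -
  have "F (\<lambda>i. F (g i) {i..n}) {1..n} = F (\<lambda>(i, j). g i j) (SIGMA i:{1..n}. {i..n})"
    by (rule Sigma) auto
  also have "\<dots> = F (\<lambda>(j, i). g i j) (SIGMA j:{1..n}. {1..j})"
    by (rule reindex_bij_witness[where i = "\<lambda>(i, j). (j, i)" and j = "\<lambda>(i, j). (j, i)"]) auto
  also have "\<dots> = F (\<lambda>j. F (\<lambda>i. g i j) {1..j}) {1..n}"
    by (rule Sigma[symmetric]) auto
  finally show ?thesis .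
qed

lemma strict_triangle_swap:
  fixes n :: nat
  shows "F (\<lambda>i. F (g i) {i + 1..n}) {1..n} = F (\<lambda>j. F (\<lambda>i. g i j) {1..j - 1}) {1..n}"
proof -
  have "F (\<lambda>i. F (g i) {i + 1..n}) {1..n} = F (\<lambda>(i, j). g i j) (SIGMA i:{1..n}. {i + 1..n})"
    by (rule Sigma) auto
  also have "\<dots> = F (\<lambda>(j, i). g i j) (SIGMA j:{1..n}. {1..j - 1})"
    by (rule reindex_bij_witness[where i = "\<lambda>(i, j). (j, i)" and j = "\<lambda>(i, j). (j, i)"]) auto
  also have "\<dots> = F (\<lambda>j. F (\<lambda>i. g i j) {1..j - 1}) {1..n}"
    by (rule Sigma[symmetric]) auto
  finally show ?thesis .
qed

lemma trap_row:
  fixes n :: nat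
  assumes "1 \<le> i" "i \<le> n"
  shows "F h {i..2 * n + m + 1 - i} = h i \<^bold>* (F h {i + 1..n} \<^bold>*
    (F (\<lambda>k. h (n + k)) {1..m} \<^bold>* F (\<lambda>k. h (2 * n + m + 1 - k)) {i..n}))"
proof -
  have "{i..2 * n + m + 1 - i} = insert i ({i + 1..n} \<union> ({n + 1..n + m} \<union> {n + m + 1..2 * n + m + 1 - i}))"
    using assms by auto
  also have "F h \<dots> = h i \<^bold>* F h ({i + 1..n} \<union> ({n + 1..n + m} \<union> {n + m + 1..2 * n + m + 1 - i}))"
    using assms by (intro insert) auto
  also have "F h ({i + 1..n} \<union> ({n + 1..n + m} \<union> {n + m + 1..2 * n + m + 1 - i}))
      = F h {i + 1..n} \<^bold>* (F h {n + 1..n + m} \<^bold>* F h {n + m + 1..2 * n + m + 1 - i})"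
    by (subst union_disjoint; (subst union_disjoint)?) auto
  also have "F h {n + 1..n + m} = F (\<lambda>k. h (n + k)) {1..m}"
    by (rule reindex_bij_witness[where i = "\<lambda>k. n + k" and j = "\<lambda>j. j - n"]) auto
  also have "F h {n + m + 1..2 * n + m + 1 - i} = F (\<lambda>k. h (2 * n + m + 1 - k)) {i..n}"
    by (rule reindex_bij_witness[where i = "\<lambda>k. 2 * n + m + 1 - k" and j = "\<lambda>j. 2 * n + m + 1 - j"])
       (use assms in auto)
  finally show ?thesis .
qed

lemma over_trap_index:
  "F h (trap_index n m) = F (\<lambda>i. F (\<lambda>j. h (i, j)) {i..2 * n + m + 1 - i}) {1..n}"
proof -
  have "trap_index n m = (SIGMA i:{1..n}. {i..2 * n + m + 1 - i})" by (auto simp: trap_index_def)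
  then show ?thesis using Sigma[of "{1..n}" "\<lambda>i. {i..2 * n + m + 1 - i}" "\<lambda>i j. h (i, j)"] by simp
qed

end

lemma shifted_shape_trap_index: "shifted_shape (trap_index n m)"
  by (auto simp: shifted_shape_def trap_index_def)

lemma prod_Gamma_trap_param:
  "(\<Prod>q\<in>trap_index n m. Gamma (trap_param n m a0 a b q))
    = (\<Prod>i = 1..n. Gamma (a i + a0) * (\<Prod>j = 1..n. Gamma (a i + a j)) * (\<Prod>k = 1..m. Gamma (a i + b k)))"
proof -
  let ?G = "\<lambda>i j. Gamma (a i + a j)"
  have row: "(\<Prod>j = i..2 * n + m + 1 - i. Gamma (trap_param n m a0 a b (i, j)))
     = Gamma (a i + a0) * ((\<Prod>j = i + 1..n. ?G i j) * ((\<Prod>k = 1..m. Gamma (a i + b k)) * (\<Prod>k = i..n. ?G i k)))"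
    if i: "1 \<le> i" "i \<le> n" for i
    unfolding prod.trap_row[OF i]
    by (intro arg_cong2[where f = "(*)"] prod.cong refl arg_cong[where f = Gamma]) (use i in \<open>auto simp: trap_param_def\<close>)
  have "(\<Prod>i = 1..n. \<Prod>j = i + 1..n. ?G i j) = (\<Prod>i = 1..n. \<Prod>j = 1..i - 1. ?G i j)"
    by (subst prod.strict_triangle_swap) (simp add: add.commute)
  moreover have "(\<Prod>j = 1..n. ?G i j) = (\<Prod>j = 1..i - 1. ?G i j) * (\<Prod>j = i..n. ?G i j)" if "1 \<le> i" "i \<le> n" for i
  proof -
    have "{1..n} = {1..i - 1} \<union> {i..n}" using that by auto
    then show ?thesis by (simp only:) (rule prod.union_disjoint, auto)
  qed
  ultimately have "(\<Prod>i = 1..n. \<Prod>j = 1..n. ?G i j)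
      = (\<Prod>i = 1..n. \<Prod>j = i + 1..n. ?G i j) * (\<Prod>i = 1..n. \<Prod>j = i..n. ?G i j)"
    by (simp flip: prod.distrib)
  moreover have "(\<Prod>q\<in>trap_index n m. Gamma (trap_param n m a0 a b q))
      = (\<Prod>i = 1..n. Gamma (a i + a0) * ((\<Prod>j = i + 1..n. ?G i j)
          * ((\<Prod>k = 1..m. Gamma (a i + b k)) * (\<Prod>k = i..n. ?G i k))))"
    unfolding prod.over_trap_index by (intro prod.cong refl row) auto
  ultimately show ?thesis
    by (simp add: prod.distrib mult_ac)
qed

lemma sum_trap_param:
  fixes L :: "nat \<times> nat \<Rightarrow> real"
  defines "R \<equiv> \<lambda>p q. \<Sum>i = 1..p. \<Sum>j = 1..q. L (min i j, max i j)"
  shows "(\<Sum>q\<in>trap_index n m. trap_param n m a0 a b q * L q)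
    = a0 * (\<Sum>i = 1..n. L (i, i)) + (\<Sum>k = 1..m. b k * (R n (n + k) - R n (n + k - 1)))
      + (\<Sum>k = 1..n. a k * (2 * R k (2 * n + m + 1 - k) - R (k - 1) (2 * n + m + 1 - k) - R k (2 * n + m - k)))"
proof -
  let ?K = "\<lambda>k. 2 * n + m + 1 - k"
  have row: "(\<Sum>j = i..?K i. trap_param n m a0 a b (i, j) * L (i, j))
     = a i * (\<Sum>j = i..?K i. L (i, j)) + (a0 * L (i, i) + ((\<Sum>j = i + 1..n. a j * L (i, j))
       + ((\<Sum>k = 1..m. b k * L (i, n + k)) + (\<Sum>k = i..n. a k * L (i, ?K k)))))"
    if i: "1 \<le> i" "i \<le> n" for i
  proof -
    have "(\<Sum>j = i..?K i. trap_param n m a0 a b (i, j) * L (i, j)) - a i * (\<Sum>j = i..?K i. L (i, j))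
        = (\<Sum>j = i..?K i. (trap_param n m a0 a b (i, j) - a i) * L (i, j))"
      by (simp add: sum_distrib_left left_diff_distrib sum_subtractf)
    also have "\<dots> = a0 * L (i, i) + ((\<Sum>j = i + 1..n. a j * L (i, j))
       + ((\<Sum>k = 1..m. b k * L (i, n + k)) + (\<Sum>k = i..n. a k * L (i, ?K k))))"
      unfolding sum.trap_row[OF i]
      by (intro arg_cong2[where f = "(+)"] sum.cong refl arg_cong2[where f = "(*)"]) (use i in \<open>auto simp: trap_param_def\<close>)
    finally show ?thesis by simp
  qed
  have col: "R n (n + k) - R n (n + k - 1) = (\<Sum>i = 1..n. L (i, n + k))" if "1 \<le> k" for k
  proof -
    have "(\<Sum>j = 1..n + k. L (min i j, max i j)) - (\<Sum>j = 1..n + k - 1. L (min i j, max i j)) = L (i, n + k)"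
      if "i \<in> {1..n}" for i
      using that \<open>1 \<le> k\<close> by (cases k) (auto simp: min_def max_def)
    then show ?thesis unfolding R_def by (simp flip: sum_subtractf)
  qed
  have hook1: "R k (?K k) - R (k - 1) (?K k) = (\<Sum>i = 1..k - 1. L (i, k)) + (\<Sum>j = k..?K k. L (k, j))"
    if k: "1 \<le> k" "k \<le> n" for k
  proof -
    have "R k (?K k) - R (k - 1) (?K k) = (\<Sum>j = 1..?K k. L (min k j, max k j))"
      using k by (cases k) (auto simp: R_def)
    also have "{1..?K k} = {1..k - 1} \<union> {k..?K k}" using k by auto
    also have "(\<Sum>j\<in>\<dots>. L (min k j, max k j)) = (\<Sum>j = 1..k - 1. L (min k j, max k j)) + (\<Sum>j = k..?K k. L (min k j, max k j))"
      using k by (intro sum.union_disjoint) auto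
    also have "\<dots> = (\<Sum>i = 1..k - 1. L (i, k)) + (\<Sum>j = k..?K k. L (k, j))"
      by (intro arg_cong2[where f = "(+)"] sum.cong) (auto simp: min_def max_def)
    finally show ?thesis .
  qed
  have hook2: "R k (?K k) - R k (2 * n + m - k) = (\<Sum>i = 1..k. L (i, ?K k))"
    if k: "1 \<le> k" "k \<le> n" for k
  proof -
    have "?K k = Suc (2 * n + m - k)" using k by auto
    then have "(\<Sum>j = 1..?K k. L (min i j, max i j)) - (\<Sum>j = 1..2 * n + m - k. L (min i j, max i j)) = L (i, ?K k)"
      if "i \<in> {1..k}" for i
      using that k by (auto simp: min_def max_def)
    then show ?thesis unfolding R_def by (simp flip: sum_subtractf)
  qed
  have "(\<Sum>q\<in>trap_index n m. trap_param n m a0 a b q * L q)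
    = (\<Sum>i = 1..n. a i * (\<Sum>j = i..?K i. L (i, j))) + (a0 * (\<Sum>i = 1..n. L (i, i)) + ((\<Sum>i = 1..n. \<Sum>j = i + 1..n. a j * L (i, j))
       + ((\<Sum>i = 1..n. \<Sum>k = 1..m. b k * L (i, n + k)) + (\<Sum>i = 1..n. \<Sum>k = i..n. a k * L (i, ?K k)))))"
  proof -
    have "(\<Sum>q\<in>trap_index n m. trap_param n m a0 a b q * L q)
        = (\<Sum>i = 1..n. a i * (\<Sum>j = i..?K i. L (i, j)) + (a0 * L (i, i) + ((\<Sum>j = i + 1..n. a j * L (i, j))
            + ((\<Sum>k = 1..m. b k * L (i, n + k)) + (\<Sum>k = i..n. a k * L (i, ?K k))))))"
      unfolding sum.over_trap_index by (intro sum.cong refl row) auto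
    then show ?thesis by (simp only: sum.distrib sum_distrib_left)
  qed
  also have "(\<Sum>i = 1..n. \<Sum>j = i + 1..n. a j * L (i, j)) = (\<Sum>k = 1..n. a k * (\<Sum>i = 1..k - 1. L (i, k)))"
    unfolding sum.strict_triangle_swap sum_distrib_left ..
  also have "(\<Sum>i = 1..n. \<Sum>k = i..n. a k * L (i, ?K k)) = (\<Sum>k = 1..n. a k * (\<Sum>i = 1..k. L (i, ?K k)))"
    unfolding sum.triangle_swap sum_distrib_left ..
  also have "(\<Sum>i = 1..n. \<Sum>k = 1..m. b k * L (i, n + k)) = (\<Sum>k = 1..m. b k * (R n (n + k) - R n (n + k - 1)))"
  proof -
    have "(\<Sum>i = 1..n. b k * L (i, n + k)) = b k * (R n (n + k) - R n (n + k - 1))" if "k \<in> {1..m}" for k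
      using col[of k] that by (simp add: sum_distrib_left)
    then show ?thesis by (subst sum.swap) (intro sum.cong refl, blast)
  qed
  finally have "(\<Sum>q\<in>trap_index n m. trap_param n m a0 a b q * L q)
    = a0 * (\<Sum>i = 1..n. L (i, i)) + (\<Sum>k = 1..m. b k * (R n (n + k) - R n (n + k - 1)))
      + (\<Sum>k = 1..n. a k * ((\<Sum>i = 1..k - 1. L (i, k)) + (\<Sum>j = k..?K k. L (k, j)) + (\<Sum>i = 1..k. L (i, ?K k))))"
    by (simp add: sum.distrib distrib_left)
  also have "(\<Sum>k = 1..n. a k * ((\<Sum>i = 1..k - 1. L (i, k)) + (\<Sum>j = k..?K k. L (k, j)) + (\<Sum>i = 1..k. L (i, ?K k))))
     = (\<Sum>k = 1..n. a k * (2 * R k (?K k) - R (k - 1) (?K k) - R k (2 * n + m - k)))"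
    by (intro sum.cong refl arg_cong2[where f = "(*)"]) (use hook1 hook2 in force)
  finally show ?thesis .
qed

lemma T_ext_diagonal: "T_ext m s (\<lambda>i. s (i, i + m)) i j = s (i, j)"
  by (auto simp: T_ext_def)

lemma Psi_ext_box:
  "Psi_ext n (\<lambda>q. s (Psi_box n m q)) (\<lambda>i. s (i, i + m)) k l
    = (if (k + 1) div 2 < l then 1 else s (l, l + m + 2 * n - k))"
  by (auto simp: Psi_ext_def Psi_box_def)

lemma energy_trap_index:
  assumes "n \<ge> 1"
  shows "energy (trap_index n m) v = 1 / v (1, 1)
    + (\<Sum>i = 2..n. \<Sum>j = i..2 * n + m + 1 - i. v (i - 1, j) / v (i, j))
    + (\<Sum>i = 1..n. \<Sum>j = i + 1..2 * n + m + 1 - i. v (i, j - 1) / v (i, j))"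
proof -
  let ?K = "\<lambda>k. 2 * n + m + 1 - k"
  have row: "(\<Sum>j = i..?K i. inflow v i j / v (i, j)) = (if i = 1 then 1 / v (1, 1) else 0)
      + (if 1 < i then (\<Sum>j = i..?K i. v (i - 1, j) / v (i, j)) else 0)
      + (\<Sum>j = i + 1..?K i. v (i, j - 1) / v (i, j))"
    if i: "i \<in> {1..n}" for i
  proof -
    have 1: "{i..?K i} = insert i {i + 1..?K i}" using i by auto
    have "(\<Sum>j = i..?K i. inflow v i j / v (i, j)) = (\<Sum>j = i..?K i. (if i = 1 \<and> j = i then 1 / v (1, 1) else 0)
      + (if 1 < i then v (i - 1, j) / v (i, j) else 0) + (if i < j then v (i, j - 1) / v (i, j) else 0))"
      using i by (intro sum.cong refl) (auto simp: inflow_def add_divide_distrib)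
    also have "\<dots> = (\<Sum>j = i..?K i. if i = 1 \<and> j = i then 1 / v (1, 1) else 0)
      + (\<Sum>j = i..?K i. if 1 < i then v (i - 1, j) / v (i, j) else 0)
      + (\<Sum>j = i..?K i. if i < j then v (i, j - 1) / v (i, j) else 0)"
      by (simp only: sum.distrib)
    also have "(\<Sum>j = i..?K i. if i = 1 \<and> j = i then 1 / v (1, 1) else 0) = (if i = 1 then 1 / v (1, 1) else 0)"
      unfolding 1 by simp
    also have "(\<Sum>j = i..?K i. if 1 < i then v (i - 1, j) / v (i, j) else 0)
        = (if 1 < i then (\<Sum>j = i..?K i. v (i - 1, j) / v (i, j)) else 0)"
      by simp
    also have "(\<Sum>j = i..?K i. if i < j then v (i, j - 1) / v (i, j) else 0) = (\<Sum>j = i + 1..?K i. v (i, j - 1) / v (i, j))"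
      unfolding 1 by simp
    finally show ?thesis .
  qed
  have "{1..n} = insert 1 {2..n}" using assms by auto
  then have a: "(\<Sum>i = 1..n. if i = 1 then 1 / v (1, 1) else 0) = 1 / v (1, 1)"
    and b: "(\<Sum>i = 1..n. if 1 < i then (\<Sum>j = i..?K i. v (i - 1, j) / v (i, j)) else 0)
      = (\<Sum>i = 2..n. \<Sum>j = i..?K i. v (i - 1, j) / v (i, j))"
    by (auto intro!: sum.cong)
  show ?thesis
    unfolding energy_def sum.over_trap_index prod.case
    using row a b by (simp only: sum.distrib cong: sum.cong)
qed

lemma Psi_energy:
  fixes s v :: "nat \<times> nat \<Rightarrow> real"
  assumes "n \<ge> 1" "r > 0" and v: "\<And>q. q \<in> trap_index n m \<Longrightarrow> v q > 0"
    and s: "\<And>q. q \<in> trap_index n m \<Longrightarrow> s q = 1 / (r * v q)"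
  defines "zz \<equiv> Psi_ext n (\<lambda>q. s (Psi_box n m q)) (\<lambda>i. s (i, i + m))"
  shows "(\<Sum>k = 1..2 * n - 1. \<Sum>l = 1..(k + 1) div 2. zz (k + 1) (l + 1) / zz k l + zz k l / zz (k + 1) l)
    = (\<Sum>i = 2..n. \<Sum>j = i + m..2 * n + m + 1 - i. v (i - 1, j) / v (i, j))
    + (\<Sum>i = 1..n. \<Sum>j = i + m + 1..2 * n + m + 1 - i. v (i, j - 1) / v (i, j))
    + r * (\<Sum>k = 1..n. v (k, 2 * n + m + 1 - k))"
proof -
  let ?K = "\<lambda>k. 2 * n + m + 1 - k"
  let ?f = "\<lambda>k l. zz (k + 1) (l + 1) / zz k l + zz k l / zz (k + 1) l"
  let ?g = "\<lambda>l j. (if j = ?K l then r * v (l, j) else v (l, j) / v (l + 1, j)) + v (l, j - 1) / v (l, j)"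
  have quot: "s p / s q = v q / v p" if "p \<in> trap_index n m" "q \<in> trap_index n m" for p q
    unfolding s[OF that(1)] s[OF that(2)] using v[OF that(1)] v[OF that(2)] \<open>r > 0\<close> by (simp add: field_simps)
  have zz: "zz k l = (if (k + 1) div 2 < l then 1 else s (l, l + m + 2 * n - k))" for k l
    unfolding zz_def by (rule Psi_ext_box)
  have term_eq: "?f k l = ?g l (l + m + 2 * n - k)" if k: "1 \<le> k" "k \<le> 2 * n - 1" and l: "1 \<le> l" "l \<le> (k + 1) div 2" for k l
  proof -
    let ?j = "l + m + 2 * n - k"
    have ij: "(l, ?j) \<in> trap_index n m" "(l, ?j - 1) \<in> trap_index n m"
      using k l by (auto simp: trap_index_def)
    have z1: "zz k l = s (l, ?j)" using l by (simp add: zz)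
    have "l + m + 2 * n - (k + 1) = ?j - 1" by simp
    then have z2: "zz (k + 1) l = s (l, ?j - 1)" using l by (simp add: zz)
    have h: "zz k l / zz (k + 1) l = v (l, ?j - 1) / v (l, ?j)"
      unfolding z1 z2 by (rule quot[OF ij])
    show ?thesis
    proof (cases "k = 2 * l - 1")
      case True
      then have "?j = ?K l" using k l by auto
      moreover have "zz (k + 1) (l + 1) = 1" using True l by (simp add: zz)
      ultimately show ?thesis using h z1 s[OF ij(1)] by simp
    next
      case False
      then have "2 * l \<le> k" using l by auto
      then have "?j \<noteq> ?K l" "(l + 1, ?j) \<in> trap_index n m" using k l by (auto simp: trap_index_def)
      moreover have "zz (k + 1) (l + 1) = s (l + 1, ?j)" using \<open>2 * l \<le> k\<close> k by (simp add: zz)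
      ultimately show ?thesis using h quot[OF _ ij(1), of "(l + 1, ?j)"] z1 by simp
    qed
  qed
  have "(\<Sum>k = 1..2 * n - 1. \<Sum>l = 1..(k + 1) div 2. ?f k l)
      = (\<Sum>(k, l)\<in>(SIGMA k:{1..2 * n - 1}. {1..(k + 1) div 2}). ?f k l)"
    by (rule sum.Sigma) auto
  also have "\<dots> = (\<Sum>(l, j)\<in>(SIGMA l:{1..n}. {l + m + 1..?K l}). ?g l j)"
  proof (rule sum.reindex_bij_witness[where i = "\<lambda>(l, j). (l + m + 2 * n - j, l)" and j = "\<lambda>(k, l). (l, l + m + 2 * n - k)"])
    fix p assume "p \<in> (SIGMA k:{1..2 * n - 1}. {1..(k + 1) div 2})"
    then obtain k l where p: "p = (k, l)" "1 \<le> k" "k \<le> 2 * n - 1" "1 \<le> l" "l \<le> (k + 1) div 2" by auto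
    show "(case case p of (k, l) \<Rightarrow> (l, l + m + 2 * n - k) of (l, j) \<Rightarrow> ?g l j) = (case p of (k, l) \<Rightarrow> ?f k l)"
      using term_eq[OF p(2-5)] p(1) by simp
  qed auto
  also have "\<dots> = (\<Sum>l = 1..n. \<Sum>j = l + m + 1..?K l. ?g l j)"
    by (rule sum.Sigma[symmetric]) auto
  also have "\<dots> = (\<Sum>l = 1..n. r * v (l, ?K l) + (\<Sum>j = l + m + 1..2 * n + m - l. v (l, j) / v (l + 1, j))
      + (\<Sum>j = l + m + 1..?K l. v (l, j - 1) / v (l, j)))"
  proof (intro sum.cong refl)
    fix l assume l: "l \<in> {1..n}"
    then have e: "{l + m + 1..?K l} = insert (?K l) {l + m + 1..2 * n + m - l}" by auto
    have "(\<Sum>j = l + m + 1..?K l. if j = ?K l then r * v (l, j) else v (l, j) / v (l + 1, j))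
        = r * v (l, ?K l) + (\<Sum>j = l + m + 1..2 * n + m - l. if j = ?K l then r * v (l, j) else v (l, j) / v (l + 1, j))"
      unfolding e using l by (subst sum.insert) auto
    also have "(\<Sum>j = l + m + 1..2 * n + m - l. if j = ?K l then r * v (l, j) else v (l, j) / v (l + 1, j))
        = (\<Sum>j = l + m + 1..2 * n + m - l. v (l, j) / v (l + 1, j))"
      using l by (intro sum.cong) auto
    finally show "(\<Sum>j = l + m + 1..?K l. ?g l j) = r * v (l, ?K l)
      + (\<Sum>j = l + m + 1..2 * n + m - l. v (l, j) / v (l + 1, j)) + (\<Sum>j = l + m + 1..?K l. v (l, j - 1) / v (l, j))"
      by (simp only: sum.distrib)
  qed
  also have "\<dots> = r * (\<Sum>k = 1..n. v (k, ?K k))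
      + (\<Sum>l = 1..n. \<Sum>j = l + m + 1..2 * n + m - l. v (l, j) / v (l + 1, j))
      + (\<Sum>i = 1..n. \<Sum>j = i + m + 1..?K i. v (i, j - 1) / v (i, j))"
    by (simp only: sum.distrib sum_distrib_left)
  also have "(\<Sum>l = 1..n. \<Sum>j = l + m + 1..2 * n + m - l. v (l, j) / v (l + 1, j))
      = (\<Sum>i = 2..n. \<Sum>j = i + m..?K i. v (i - 1, j) / v (i, j))"
  proof -
    have "(\<Sum>l = 1..n. \<Sum>j = l + m + 1..2 * n + m - l. v (l, j) / v (l + 1, j))
        = (\<Sum>l = 1..n - 1. \<Sum>j = l + m + 1..2 * n + m - l. v (l, j) / v (l + 1, j))"
      using \<open>n \<ge> 1\<close> by (cases n) auto
    also have "\<dots> = (\<Sum>i = 2..n. \<Sum>j = i + m..?K i. v (i - 1, j) / v (i, j))"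
      by (rule sum.reindex_bij_witness[where i = "\<lambda>i. i - 1" and j = "\<lambda>l. l + 1"]) (auto intro!: sum.cong)
    finally show ?thesis .
  qed
  finally show ?thesis by simp
qed

lemma T_Psi_energy:
  fixes s v :: "nat \<times> nat \<Rightarrow> real"
  assumes "n \<ge> 1" "r > 0" and v: "\<And>q. q \<in> trap_index n m \<Longrightarrow> v q > 0"
    and s: "\<And>q. q \<in> trap_index n m \<Longrightarrow> s q = 1 / (r * v q)"
  defines "zz \<equiv> Psi_ext n (\<lambda>q. s (Psi_box n m q)) (\<lambda>i. s (i, i + m))"
  shows "r * s (1, 1) + (\<Sum>i = 2..n. \<Sum>j = i..i + m - 1. s (i, j) / s (i - 1, j))
      + (\<Sum>i = 1..n. \<Sum>j = i..i + m - 1. s (i, j + 1) / s (i, j))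
      + (\<Sum>k = 1..2 * n - 1. \<Sum>l = 1..(k + 1) div 2. zz (k + 1) (l + 1) / zz k l + zz k l / zz (k + 1) l)
    = energy (trap_index n m) v + r * (\<Sum>k = 1..n. v (k, 2 * n + m + 1 - k))"
proof -
  let ?K = "\<lambda>k. 2 * n + m + 1 - k"
  have quot: "s p / s q = v q / v p" if "p \<in> trap_index n m" "q \<in> trap_index n m" for p q
    unfolding s[OF that(1)] s[OF that(2)] using v[OF that(1)] v[OF that(2)] \<open>r > 0\<close> by (simp add: field_simps)
  have 0: "r * s (1, 1) = 1 / v (1, 1)"
    using s[of "(1, 1)"] \<open>n \<ge> 1\<close> \<open>r > 0\<close> by (auto simp: trap_index_def)
  have 1: "(\<Sum>j = i..i + m - 1. s (i, j) / s (i - 1, j)) + (\<Sum>j = i + m..?K i. v (i - 1, j) / v (i, j))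
      = (\<Sum>j = i..?K i. v (i - 1, j) / v (i, j))" if i: "i \<in> {2..n}" for i
  proof -
    have "(\<Sum>j = i..i + m - 1. s (i, j) / s (i - 1, j)) = (\<Sum>j = i..i + m - 1. v (i - 1, j) / v (i, j))"
      using i by (intro sum.cong refl quot) (auto simp: trap_index_def)
    moreover have "{i..?K i} = {i..i + m - 1} \<union> {i + m..?K i}" using i by auto
    moreover have "(\<Sum>j\<in>{i..i + m - 1} \<union> {i + m..?K i}. v (i - 1, j) / v (i, j))
        = (\<Sum>j = i..i + m - 1. v (i - 1, j) / v (i, j)) + (\<Sum>j = i + m..?K i. v (i - 1, j) / v (i, j))"
      using i by (intro sum.union_disjoint) auto
    ultimately show ?thesis by simp
  qed
  have 2: "(\<Sum>j = i..i + m - 1. s (i, j + 1) / s (i, j)) + (\<Sum>j = i + m + 1..?K i. v (i, j - 1) / v (i, j))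
      = (\<Sum>j = i + 1..?K i. v (i, j - 1) / v (i, j))" if i: "i \<in> {1..n}" for i
  proof -
    have "(\<Sum>j = i..i + m - 1. s (i, j + 1) / s (i, j)) = (\<Sum>j = i..i + m - 1. v (i, j) / v (i, j + 1))"
      using i by (intro sum.cong refl quot) (auto simp: trap_index_def)
    also have "\<dots> = (\<Sum>j = i + 1..i + m. v (i, j - 1) / v (i, j))"
      by (rule sum.reindex_bij_witness[where i = "\<lambda>j. j - 1" and j = "\<lambda>j. j + 1"]) (use i in auto)
    finally have "(\<Sum>j = i..i + m - 1. s (i, j + 1) / s (i, j)) = (\<Sum>j = i + 1..i + m. v (i, j - 1) / v (i, j))" .
    moreover have "{i + 1..?K i} = {i + 1..i + m} \<union> {i + m + 1..?K i}" using i by auto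
    moreover have "(\<Sum>j\<in>{i + 1..i + m} \<union> {i + m + 1..?K i}. v (i, j - 1) / v (i, j))
        = (\<Sum>j = i + 1..i + m. v (i, j - 1) / v (i, j)) + (\<Sum>j = i + m + 1..?K i. v (i, j - 1) / v (i, j))"
      using i by (intro sum.union_disjoint) auto
    ultimately show ?thesis by simp
  qed
  have v': "(\<Sum>i = 2..n. \<Sum>j = i..i + m - 1. s (i, j) / s (i - 1, j))
      + (\<Sum>i = 2..n. \<Sum>j = i + m..?K i. v (i - 1, j) / v (i, j)) = (\<Sum>i = 2..n. \<Sum>j = i..?K i. v (i - 1, j) / v (i, j))"
    unfolding sum.distrib[symmetric] by (intro sum.cong refl 1)
  have h': "(\<Sum>i = 1..n. \<Sum>j = i..i + m - 1. s (i, j + 1) / s (i, j))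
      + (\<Sum>i = 1..n. \<Sum>j = i + m + 1..?K i. v (i, j - 1) / v (i, j)) = (\<Sum>i = 1..n. \<Sum>j = i + 1..?K i. v (i, j - 1) / v (i, j))"
    unfolding sum.distrib[symmetric] by (intro sum.cong refl 2)
  show ?thesis
    unfolding energy_trap_index[OF \<open>n \<ge> 1\<close>]
    using 0 v' h' Psi_energy[of n r m v s, OF assms(1-4), folded zz_def] by linarith
qed

lemma prod_alternating_powr:
  assumes "\<And>i. 1 \<le> i \<Longrightarrow> i \<le> n \<Longrightarrow> v (i, i) > 0"
  shows "(\<Prod>i = 1..n. (1 / v (i, i)) powr ((-1) ^ (n - i))) = 1 / alternating_diag v n"
  using assms
proof (induction n)
  case (Suc n)
  have "(\<Prod>i = 1..n. (1 / v (i, i)) powr ((-1) ^ (Suc n - i))) = (\<Prod>i = 1..n. inverse ((1 / v (i, i)) powr ((-1) ^ (n - i))))"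
  proof (intro prod.cong refl)
    fix i assume "i \<in> {1..n}"
    then have "(-1) ^ (Suc n - i) = - ((-1) ^ (n - i) :: real)" by (simp add: Suc_diff_le)
    then show "(1 / v (i, i)) powr ((-1) ^ (Suc n - i)) = inverse ((1 / v (i, i)) powr ((-1) ^ (n - i)))"
      by (simp only: powr_minus)
  qed
  also have "\<dots> = inverse (\<Prod>i = 1..n. (1 / v (i, i)) powr ((-1) ^ (n - i)))"
    by (simp only: prod_inversef[symmetric] o_def)
  also have "\<dots> = alternating_diag v n"
    using Suc by (simp add: inverse_eq_divide)
  finally show ?case
    using Suc.prems[of "Suc n"] by simp
qed simp

lemma prod_pairs:
  fixes f :: "nat \<Rightarrow> 'a :: comm_monoid_mult"
  shows "(\<Prod>i = 1..2 * n. f i) = (\<Prod>k = 1..n. f (2 * k - 1) * f (2 * k))"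
  by (induction n) (simp_all add: mult_ac)

lemma ln_prod_pos:
  fixes f :: "'a \<Rightarrow> real"
  assumes "finite A" "\<And>i. i \<in> A \<Longrightarrow> f i > 0"
  shows "ln (\<Prod>i\<in>A. f i) = (\<Sum>i\<in>A. ln (f i))"
  using assms by (intro ln_prod) (auto dest: assms(2))

lemma ln_diag_prod:
  assumes "\<And>i. 1 \<le> i \<Longrightarrow> i \<le> p \<Longrightarrow> v (i, i + d) > 0"
  shows "ln (diag_prod v p d) = (\<Sum>i = 1..p. ln (v (i, i + d)))"
  unfolding diag_prod_def using assms by (intro ln_prod_pos) auto

lemma T_prefactor:
  fixes s v :: "nat \<times> nat \<Rightarrow> real"
  assumes "r > 0" and v: "\<And>q. q \<in> trap_index n m \<Longrightarrow> v q > 0"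
    and s: "\<And>q. q \<in> trap_index n m \<Longrightarrow> s q = 1 / (r * v q)"
  shows "(\<Prod>j = 1..m. \<Prod>i = 1..n. (s (i, i + j) / s (i, i + j - 1)) powr b j)
    = exp (\<Sum>j = 1..m. b j * (ln (diag_prod v n (j - 1)) - ln (diag_prod v n j)))"
proof -
  have mem: "(i, i + j) \<in> trap_index n m" if "1 \<le> i" "i \<le> n" "j \<le> m" for i j
    using that by (auto simp: trap_index_def)
  have "(\<Prod>i = 1..n. (s (i, i + j) / s (i, i + j - 1)) powr b j)
      = exp (b j * (ln (diag_prod v n (j - 1)) - ln (diag_prod v n j)))" if j: "j \<in> {1..m}" for j
  proof -
    have "(s (i, i + j) / s (i, i + j - 1)) powr b j = exp (b j * (ln (v (i, i + (j - 1))) - ln (v (i, i + j))))"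
      if i: "i \<in> {1..n}" for i
    proof -
      have e: "i + j - 1 = i + (j - 1)" using j by auto
      have "(i, i + j) \<in> trap_index n m" "(i, i + (j - 1)) \<in> trap_index n m" using i j mem[of i j] mem[of i "j - 1"] by auto
      note * = s[OF this(1)] s[OF this(2)] v[OF this(1)] v[OF this(2)]
      have "s (i, i + j) / s (i, i + j - 1) = v (i, i + (j - 1)) / v (i, i + j)"
        unfolding e *(1,2) using *(3,4) \<open>r > 0\<close> by (simp add: field_simps)
      then show ?thesis using *(3,4) by (simp add: powr_def ln_div)
    qed
    then have "(\<Prod>i = 1..n. (s (i, i + j) / s (i, i + j - 1)) powr b j)
        = exp (\<Sum>i = 1..n. b j * (ln (v (i, i + (j - 1))) - ln (v (i, i + j))))"
      by (simp add: exp_sum)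
    also have "(\<Sum>i = 1..n. b j * (ln (v (i, i + (j - 1))) - ln (v (i, i + j))))
        = b j * (ln (diag_prod v n (j - 1)) - ln (diag_prod v n j))"
    proof -
      have lnd: "ln (diag_prod v n d) = (\<Sum>i = 1..n. ln (v (i, i + d)))" if "d \<le> m" for d
        by (rule ln_diag_prod) (use that in \<open>auto intro!: v mem\<close>)
      have "j - 1 \<le> m" "j \<le> m" using j by auto
      then show ?thesis
        by (simp only: lnd sum_distrib_left sum_subtractf right_diff_distrib)
    qed
    finally show ?thesis .
  qed
  then show ?thesis by (simp add: exp_sum)
qed

lemma Psi_prefactor:
  fixes s v :: "nat \<times> nat \<Rightarrow> real"
  assumes "r > 0" and v: "\<And>q. q \<in> trap_index n m \<Longrightarrow> v q > 0"
    and s: "\<And>q. q \<in> trap_index n m \<Longrightarrow> s q = 1 / (r * v q)"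
  defines "zz \<equiv> Psi_ext n (\<lambda>q. s (Psi_box n m q)) (\<lambda>i. s (i, i + m))"
  shows "(\<Prod>k = 1..2 * n. so_type zz k powr alpha_pm a k) = exp (\<Sum>k = 1..n. a k *
    (- ln r - 2 * ln (diag_prod v k (2 * n + m + 1 - 2 * k)) + ln (diag_prod v (k - 1) (2 * n + m + 2 - 2 * k))
     + ln (diag_prod v k (2 * n + m - 2 * k))))"
proof -
  define P where "P k = (\<Prod>l = 1..(k + 1) div 2. zz k l)" for k
  have P: "P k > 0 \<and> ln (P k) = - real ((k + 1) div 2) * ln r - ln (diag_prod v ((k + 1) div 2) (m + 2 * n - k))"
    if k: "k \<le> 2 * n" for k
  proof -
    have mem: "(l, l + (m + 2 * n - k)) \<in> trap_index n m" if "1 \<le> l" "l \<le> (k + 1) div 2" for l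
      using that k by (auto simp: trap_index_def)
    have zz: "zz k l = 1 / (r * v (l, l + (m + 2 * n - k)))" if "1 \<le> l" "l \<le> (k + 1) div 2" for l
    proof -
      have "zz k l = s (l, l + (m + 2 * n - k))"
        unfolding zz_def Psi_ext_box using that k by (simp add: add.assoc)
      then show ?thesis using s[OF mem[OF that]] by simp
    qed
    have pos: "zz k l > 0" if "1 \<le> l" "l \<le> (k + 1) div 2" for l
      using zz[OF that] v[OF mem[OF that]] \<open>r > 0\<close> by simp
    have "ln (P k) = (\<Sum>l = 1..(k + 1) div 2. ln (zz k l))"
      unfolding P_def using pos by (intro ln_prod_pos) auto
    also have "\<dots> = (\<Sum>l = 1..(k + 1) div 2. - ln r - ln (v (l, l + (m + 2 * n - k))))"
    proof (intro sum.cong refl)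
      fix l assume "l \<in> {1..(k + 1) div 2}"
      then have l: "1 \<le> l" "l \<le> (k + 1) div 2" by auto
      then show "ln (zz k l) = - ln r - ln (v (l, l + (m + 2 * n - k)))"
        unfolding zz[OF l] using v[OF mem[OF l]] \<open>r > 0\<close> by (simp add: ln_div ln_mult)
    qed
    also have "\<dots> = - real ((k + 1) div 2) * ln r - ln (diag_prod v ((k + 1) div 2) (m + 2 * n - k))"
      using v mem by (subst ln_diag_prod) (auto simp: sum_subtractf)
    finally show ?thesis
      unfolding P_def using pos by (auto intro!: prod_pos)
  qed
  have st: "so_type zz k = P k / P (k - 1)" if "1 \<le> k" for k
    using that by (cases k) (simp_all add: so_type_def P_def)
  have "so_type zz (2 * k - 1) powr alpha_pm a (2 * k - 1) * so_type zz (2 * k) powr alpha_pm a (2 * k)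
    = exp (a k * (- ln r - 2 * ln (diag_prod v k (2 * n + m + 1 - 2 * k))
       + ln (diag_prod v (k - 1) (2 * n + m + 2 - 2 * k)) + ln (diag_prod v k (2 * n + m - 2 * k))))"
    if k: "k \<in> {1..n}" for k
  proof -
    have k': "1 \<le> k" "k \<le> n" using k by auto
    have al: "alpha_pm a (2 * k - 1) = a k" "alpha_pm a (2 * k) = - a k"
      using k' by (auto simp: alpha_pm_def)
    have p0: "P (2 * k - 2) > 0" "ln (P (2 * k - 2)) = - real (k - 1) * ln r - ln (diag_prod v (k - 1) (2 * n + m + 2 - 2 * k))"
    proof -
      have "(2 * k - 2 + 1) div 2 = k - 1" "m + 2 * n - (2 * k - 2) = 2 * n + m + 2 - 2 * k" using k' by auto
      then show "P (2 * k - 2) > 0" "ln (P (2 * k - 2)) = - real (k - 1) * ln r - ln (diag_prod v (k - 1) (2 * n + m + 2 - 2 * k))"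
        using P[of "2 * k - 2"] k' by simp_all
    qed
    have p1: "P (2 * k - 1) > 0" "ln (P (2 * k - 1)) = - real k * ln r - ln (diag_prod v k (2 * n + m + 1 - 2 * k))"
    proof -
      have "(2 * k - 1 + 1) div 2 = k" "m + 2 * n - (2 * k - 1) = 2 * n + m + 1 - 2 * k" using k' by auto
      then show "P (2 * k - 1) > 0" "ln (P (2 * k - 1)) = - real k * ln r - ln (diag_prod v k (2 * n + m + 1 - 2 * k))"
        using P[of "2 * k - 1"] k' by simp_all
    qed
    have p2: "P (2 * k) > 0" "ln (P (2 * k)) = - real k * ln r - ln (diag_prod v k (2 * n + m - 2 * k))"
    proof -
      have "(2 * k + 1) div 2 = k" "m + 2 * n - 2 * k = 2 * n + m - 2 * k" using k' by auto
      then show "P (2 * k) > 0" "ln (P (2 * k)) = - real k * ln r - ln (diag_prod v k (2 * n + m - 2 * k))"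
        using P[of "2 * k"] k' by simp_all
    qed
    have s1: "so_type zz (2 * k - 1) = P (2 * k - 1) / P (2 * k - 2)"
    proof -
      have "2 * k - 1 - 1 = 2 * k - 2" by simp
      then show ?thesis using st[of "2 * k - 1"] k' by simp
    qed
    have s2: "so_type zz (2 * k) = P (2 * k) / P (2 * k - 1)" using st[of "2 * k"] k' by simp
    have "so_type zz (2 * k - 1) powr alpha_pm a (2 * k - 1) * so_type zz (2 * k) powr alpha_pm a (2 * k)
      = exp (a k * (ln (P (2 * k - 1)) - ln (P (2 * k - 2))) + (- a k) * (ln (P (2 * k)) - ln (P (2 * k - 1))))"
      unfolding al s1 s2 using p0(1) p1(1) p2(1) by (simp add: powr_def ln_div flip: exp_add)
    also have "a k * (ln (P (2 * k - 1)) - ln (P (2 * k - 2))) + (- a k) * (ln (P (2 * k)) - ln (P (2 * k - 1)))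
      = a k * (- ln r - 2 * ln (diag_prod v k (2 * n + m + 1 - 2 * k))
       + ln (diag_prod v (k - 1) (2 * n + m + 2 - 2 * k)) + ln (diag_prod v k (2 * n + m - 2 * k)))"
      unfolding p0(2) p1(2) p2(2) using k' by (simp add: of_nat_diff algebra_simps)
    finally show ?thesis .
  qed
  then show ?thesis unfolding prod_pairs by (simp add: exp_sum)
qed

lemma ln_sym_rect_prod:
  assumes I: "shifted_shape I" "p = 0 \<or> (p, q) \<in> I" and w: "\<And>x. x \<in> I \<Longrightarrow> w x > 0"
  shows "ln (sym_rect_prod w p q) = (\<Sum>i = 1..p. \<Sum>j = 1..q. ln (w (min i j, max i j)))"
proof (cases "p = 0")
  case False
  then have pq: "(p, q) \<in> I" using I by auto
  have pos: "w (min i j, max i j) > 0" if "i \<in> {1..p}" "j \<in> {1..q}" for i j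
    using that shifted_shapeD(2)[OF I(1) pq] by (intro w shifted_shapeD(3)[OF I(1) pq]) auto
  have "ln (sym_rect_prod w p q) = (\<Sum>i = 1..p. ln (\<Prod>j = 1..q. w (min i j, max i j)))"
    unfolding sym_rect_prod_def by (intro ln_prod_pos prod_pos) (use pos in auto)
  also have "\<dots> = (\<Sum>i = 1..p. \<Sum>j = 1..q. ln (w (min i j, max i j)))"
    by (intro sum.cong refl ln_prod_pos) (use pos in auto)
  finally show ?thesis .
qed simp

lemma joint_integrand_rsk_image:
  fixes s v w :: "nat \<times> nat \<Rightarrow> real"
  assumes n: "n \<ge> 1" and r: "r > 0" and w: "\<And>q. q \<in> trap_index n m \<Longrightarrow> w q > 0"
    and rsk: "rsk_image (trap_index n m) (trap_index n m) w v"
    and s: "\<And>q. q \<in> trap_index n m \<Longrightarrow> s q = 1 / (r * v q)"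
  shows "r powr (\<Sum>k = 1..n. a k) * joint_integrand n m a0 a b r s
    = (\<Prod>q\<in>trap_index n m. w q powr (- trap_param n m a0 a b q) * exp (- 1 / w q))
      * exp (- r * (\<Sum>k = 1..n. path_sum w k (2 * n + m + 1 - k)))"
proof -
  let ?I = "trap_index n m"
  define R where "R = (\<lambda>p q. \<Sum>i = 1..p. \<Sum>j = 1..q. ln (w (min i j, max i j)))"
  let ?K = "\<lambda>k. 2 * n + m + 1 - k"
  let ?zz = "Psi_ext n (\<lambda>q. s (Psi_box n m q)) (\<lambda>i. s (i, i + m))"
  have v: "\<And>q. q \<in> ?I \<Longrightarrow> v q > 0"
    and en: "energy ?I v = (\<Sum>x\<in>?I. 1 / w x)"
    and path: "\<And>i j. border_box ?I i j \<Longrightarrow> v (i, j) = path_sum w i j"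
    and diag: "\<And>i j. border_box ?I i j \<Longrightarrow> diag_prod v i (j - i) = sym_rect_prod w i j"
    and alt: "\<And>p. border_box ?I p p \<Longrightarrow> alternating_diag v p = (\<Prod>i = 1..p. w (i, i))"
    using rsk unfolding rsk_image_def by blast+
  have lnD: "ln (diag_prod v i d) = R i (i + d)" if "i = 0 \<or> border_box ?I i (i + d)" for i d
  proof (cases "i = 0")
    case False
    then have b: "border_box ?I i (i + d)" using that by auto
    then have "diag_prod v i d = sym_rect_prod w i (i + d)" using diag[OF b] by simp
    then show ?thesis
      unfolding R_def using b ln_sym_rect_prod[OF shifted_shape_trap_index, of i "i + d" n m w] w
      by (simp add: border_box_def)
  qed (simp add: R_def)
  have A: "(\<Prod>i = 1..n. (r * s (i, i)) powr ((-1) ^ (n - i))) powr a0 = exp (- a0 * (\<Sum>i = 1..n. ln (w (i, i))))"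
  proof -
    have mem: "(i, i) \<in> ?I" if "1 \<le> i" "i \<le> n" for i using that by (auto simp: trap_index_def)
    have "(\<Prod>i = 1..n. (r * s (i, i)) powr ((-1) ^ (n - i))) = (\<Prod>i = 1..n. (1 / v (i, i)) powr ((-1) ^ (n - i)))"
      using r by (intro prod.cong refl) (simp add: s[OF mem])
    also have "\<dots> = 1 / alternating_diag v n"
      using v mem by (intro prod_alternating_powr) auto
    also have "alternating_diag v n = (\<Prod>i = 1..n. w (i, i))"
      using n by (intro alt) (auto simp: border_box_def trap_index_def)
    finally have e: "(\<Prod>i = 1..n. (r * s (i, i)) powr ((-1) ^ (n - i))) = 1 / (\<Prod>i = 1..n. w (i, i))" .
    have p: "(\<Prod>i = 1..n. w (i, i)) > 0" and l: "ln (\<Prod>i = 1..n. w (i, i)) = (\<Sum>i = 1..n. ln (w (i, i)))"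
      using w mem by (auto intro!: prod_pos ln_prod_pos)
    have "ln (1 / x) = - ln x" if "x > 0" for x :: real
      using that by (simp add: ln_div)
    from this[OF p] have "ln (1 / (\<Prod>i = 1..n. w (i, i))) = - (\<Sum>i = 1..n. ln (w (i, i)))"
      unfolding l .
    moreover have "1 / (\<Prod>i = 1..n. w (i, i)) \<noteq> 0"
      using divide_pos_pos[OF zero_less_one p] by (rule less_imp_neq[symmetric])
    ultimately show ?thesis unfolding e unfolding powr_def by (simp only: if_False) simp
  qed
  have B: "(\<Prod>j = 1..m. \<Prod>i = 1..n. (s (i, i + j) / s (i, i + j - 1)) powr b j)
      = exp (- (\<Sum>k = 1..m. b k * (R n (n + k) - R n (n + k - 1))))"
  proof -
    have "border_box ?I n (n + d)" if "d \<le> m" for d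
      using that n by (auto simp: border_box_def trap_index_def)
    then have D: "ln (diag_prod v n d) = R n (n + d)" if "d \<le> m" for d
      using that by (intro lnD) auto
    have "ln (diag_prod v n (k - 1)) - ln (diag_prod v n k) = - (R n (n + k) - R n (n + k - 1))" if "k \<in> {1..m}" for k
    proof -
      have "n + k - 1 = n + (k - 1)" "k - 1 \<le> m" "k \<le> m" using that by auto
      then show ?thesis by (simp only: D)
    qed
    then have "(\<Sum>j = 1..m. b j * (ln (diag_prod v n (j - 1)) - ln (diag_prod v n j)))
        = (\<Sum>k = 1..m. b k * - (R n (n + k) - R n (n + k - 1)))"
      by (intro sum.cong refl arg_cong2[where f = "(*)"])
    also have "\<dots> = - (\<Sum>k = 1..m. b k * (R n (n + k) - R n (n + k - 1)))"
      by (simp only: mult_minus_right sum_negf)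
    finally show ?thesis using T_prefactor[of r n m v s b] r v s by simp
  qed
  have C: "(\<Prod>k = 1..2 * n. so_type ?zz k powr alpha_pm a k)
      = exp (- (\<Sum>k = 1..n. a k * ln r) - (\<Sum>k = 1..n. a k * (2 * R k (?K k) - R (k - 1) (?K k) - R k (2 * n + m - k))))"
  proof -
    have "a k * (- ln r - 2 * ln (diag_prod v k (2 * n + m + 1 - 2 * k)) + ln (diag_prod v (k - 1) (2 * n + m + 2 - 2 * k))
         + ln (diag_prod v k (2 * n + m - 2 * k)))
       = - (a k * ln r) - a k * (2 * R k (?K k) - R (k - 1) (?K k) - R k (2 * n + m - k))" if k: "k \<in> {1..n}" for k
    proof -
      have e: "k + (2 * n + m + 1 - 2 * k) = ?K k" "k - 1 + (2 * n + m + 2 - 2 * k) = ?K k"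
        "k + (2 * n + m - 2 * k) = 2 * n + m - k" using k by auto
      have border: "border_box ?I k (?K k)" "k - 1 = 0 \<or> border_box ?I (k - 1) (?K k)"
        "border_box ?I k (2 * n + m - k)"
        using k by (auto simp: border_box_def trap_index_def)
      have "ln (diag_prod v k (2 * n + m + 1 - 2 * k)) = R k (?K k)"
        using lnD[of k "2 * n + m + 1 - 2 * k"] border unfolding e by blast
      moreover have "ln (diag_prod v (k - 1) (2 * n + m + 2 - 2 * k)) = R (k - 1) (?K k)"
        using lnD[of "k - 1" "2 * n + m + 2 - 2 * k"] border unfolding e by blast
      moreover have "ln (diag_prod v k (2 * n + m - 2 * k)) = R k (2 * n + m - k)"
        using lnD[of k "2 * n + m - 2 * k"] border unfolding e by blast
      ultimately show ?thesis by (simp add: algebra_simps)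
    qed
    then have "(\<Sum>k = 1..n. a k * (- ln r - 2 * ln (diag_prod v k (2 * n + m + 1 - 2 * k))
          + ln (diag_prod v (k - 1) (2 * n + m + 2 - 2 * k)) + ln (diag_prod v k (2 * n + m - 2 * k))))
       = (\<Sum>k = 1..n. - (a k * ln r) - a k * (2 * R k (?K k) - R (k - 1) (?K k) - R k (2 * n + m - k)))"
      by (intro sum.cong refl)
    also have "\<dots> = - (\<Sum>k = 1..n. a k * ln r)
        - (\<Sum>k = 1..n. a k * (2 * R k (?K k) - R (k - 1) (?K k) - R k (2 * n + m - k)))"
      by (simp only: sum_subtractf sum_negf)
    finally show ?thesis using Psi_prefactor[of r n m v s a] r v s by simp
  qed
  have E: "r * s (1, 1) + (\<Sum>i = 2..n. \<Sum>j = i..i + m - 1. s (i, j) / s (i - 1, j))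
      + (\<Sum>i = 1..n. \<Sum>j = i..i + m - 1. s (i, j + 1) / s (i, j))
      + (\<Sum>k = 1..2 * n - 1. \<Sum>l = 1..(k + 1) div 2. ?zz (k + 1) (l + 1) / ?zz k l + ?zz k l / ?zz (k + 1) l)
    = (\<Sum>x\<in>?I. 1 / w x) + r * (\<Sum>k = 1..n. path_sum w k (?K k))"
  proof -
    have "(\<Sum>k = 1..n. v (k, ?K k)) = (\<Sum>k = 1..n. path_sum w k (?K k))"
      by (intro sum.cong refl path) (auto simp: border_box_def trap_index_def)
    then show ?thesis using T_Psi_energy[where s = s and v = v, OF n r v s] en by simp
  qed
  have W: "(\<Prod>q\<in>?I. w q powr (- trap_param n m a0 a b q) * exp (- 1 / w q))
      = exp (- (\<Sum>q\<in>?I. trap_param n m a0 a b q * ln (w q)) - (\<Sum>x\<in>?I. 1 / w x))"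
  proof -
    have "(\<Prod>q\<in>?I. w q powr (- trap_param n m a0 a b q) * exp (- 1 / w q))
        = (\<Prod>q\<in>?I. exp (- (trap_param n m a0 a b q * ln (w q)) - 1 / w q))"
      using w by (intro prod.cong refl) (auto simp: powr_def exp_diff exp_minus field_simps dest!: w)
    also have "\<dots> = exp (\<Sum>q\<in>?I. - (trap_param n m a0 a b q * ln (w q)) - 1 / w q)"
      by (rule exp_sum[symmetric, OF finite_trap_index])
    finally show ?thesis by (simp add: sum_subtractf sum_negf)
  qed
  have r': "r powr (\<Sum>k = 1..n. a k) = exp (\<Sum>k = 1..n. a k * ln r)"
    using r by (simp add: powr_def sum_distrib_right)
  have S: "(\<Sum>q\<in>?I. trap_param n m a0 a b q * ln (w q))
    = a0 * (\<Sum>i = 1..n. ln (w (i, i))) + (\<Sum>k = 1..m. b k * (R n (n + k) - R n (n + k - 1)))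
      + (\<Sum>k = 1..n. a k * (2 * R k (?K k) - R (k - 1) (?K k) - R k (2 * n + m - k)))"
    unfolding R_def by (rule sum_trap_param)
  show ?thesis
    unfolding joint_integrand_def T_integrand_def Psi_integrand_def Let_def T_ext_diagonal A B C W r'
    unfolding exp_add[symmetric] mult_minus_left
    by (rule arg_cong[where f = exp]) (use E S in linarith)
qed

theorem theorem3p1:
  fixes n m :: nat and a0 r :: real and a b :: "nat \<Rightarrow> real"
    and M :: "'w measure" and W :: "nat \<times> nat \<Rightarrow> 'w \<Rightarrow> real"
  assumes "n \<ge> 1"
    and "\<And>i. i \<in> {1..n} \<Longrightarrow> a i + a0 > 0"
    and "\<And>i j. i \<in> {1..n} \<Longrightarrow> j \<in> {1..n} \<Longrightarrow> a i + a j > 0"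
    and "\<And>i k. i \<in> {1..n} \<Longrightarrow> k \<in> {1..m} \<Longrightarrow> a i + b k > 0"
    and "prob_space M"
    and "prob_space.indep_vars M (\<lambda>_. borel) W (trap_index n m)"
    and "\<And>q. q \<in> trap_index n m \<Longrightarrow>
           distr M lborel (W q) = inv_gamma_measure (trap_param n m a0 a b q)"
    and "r > 0"
  shows "ennreal (\<integral>\<omega>. exp (- r * Z_trap n m W \<omega>) \<partial>M)
       = ennreal (r powr (\<Sum>k = 1..n. a k)
            / (\<Prod>i = 1..n. Gamma (a i + a0) * (\<Prod>j = 1..n. Gamma (a i + a j))
                             * (\<Prod>k = 1..m. Gamma (a i + b k))))
         * (\<integral>\<^sup>+ x. T_fun n m a0 b r x * Psi_so n a x \<partial>(PiM {1..n} (\<lambda>_. haar_pos)))"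
proof -
  interpret prob_space M by fact
  let ?I = "trap_index n m" and ?\<theta> = "trap_param n m a0 a b"
  let ?Z = "\<lambda>w. \<Sum>k = 1..n. path_sum w k (2 * n + m + 1 - k)"
  let ?g = "\<lambda>w. ennreal (exp (- r * ?Z w))"
  define \<Gamma> where "\<Gamma> = (\<Prod>q\<in>?I. Gamma (?\<theta> q))"
  have \<theta>: "?\<theta> q > 0" if "q \<in> ?I" for q
  proof -
    obtain i j where q: "q = (i, j)" by (cases q)
    have ij: "1 \<le> i" "i \<le> n" "i \<le> j" "j \<le> 2 * n + m + 1 - i"
      using that unfolding q by (auto simp: trap_index_def)
    consider "j \<le> n" | "n < j" "j \<le> n + m" | "n + m < j" by linarith
    then show ?thesis
    proof cases
      case 1
      then show ?thesis using ij assms(2)[of i] assms(3)[of i j] unfolding q by (auto simp: trap_param_def)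
    next
      case 2
      then have "j - n \<in> {1..m}" by auto
      with 2 show ?thesis using ij assms(4)[of i "j - n"] unfolding q by (auto simp: trap_param_def)
    next
      case 3
      then have "2 * n + m + 1 - j \<in> {1..n}" using ij by auto
      with 3 show ?thesis using ij assms(3)[of i "2 * n + m + 1 - j"] unfolding q by (auto simp: trap_param_def)
    qed
  qed
  have rv: "random_variable borel (W q)" if "q \<in> ?I" for q
    using assms(6) that by (auto simp: indep_vars_def)
  have X: "(\<lambda>\<omega>. \<lambda>q\<in>?I. W q \<omega>) \<in> measurable M (haar_prod ?I)"
    using rv by (intro measurable_restrict) auto
  have Z: "Z_trap n m W \<omega> = ?Z (\<lambda>q\<in>?I. W q \<omega>)" for \<omega>
    unfolding Z_trap_eq_path_sum
    by (intro sum.cong refl path_sum_cong) (auto simp: trap_index_def)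
  have Zm[measurable]: "?Z \<in> borel_measurable (haar_prod J)" for J by measurable
  have pos: "AE \<omega> in M. \<forall>q\<in>?I. W q \<omega> > 0"
    using finite_trap_index rv assms(7) by (intro AE_finite_allI AE_inv_gamma_pos) auto
  have int: "integrable M (\<lambda>\<omega>. exp (- r * Z_trap n m W \<omega>))"
  proof (rule integrable_const_bound[where B = 1])
    show "AE \<omega> in M. norm (exp (- r * Z_trap n m W \<omega>)) \<le> 1"
      using pos
    proof (rule AE_mp, intro AE_I2 impI)
      fix \<omega> assume \<omega>: "\<forall>q\<in>?I. W q \<omega> > 0"
      have "Z_trap n m W \<omega> \<ge> 0"
        unfolding Z_trap_eq_path_sum using \<omega>
        by (intro sum_nonneg path_sum_nonneg) (auto simp: trap_index_def intro!: less_imp_le)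
      then show "norm (exp (- r * Z_trap n m W \<omega>)) \<le> 1"
        using \<open>r > 0\<close> by simp
    qed
    show "(\<lambda>\<omega>. exp (- r * Z_trap n m W \<omega>)) \<in> borel_measurable M"
      unfolding Z using measurable_compose[OF X Zm] by measurable
  qed
  obtain \<Phi> where \<Phi>: "haar_preserving ?I \<Phi>" "\<And>w. (\<forall>x\<in>?I. w x > 0) \<Longrightarrow> rsk_image ?I ?I w (\<Phi> w)"
    using rsk_exists[OF finite_trap_index shifted_shape_trap_index order.refl] by blast
  define \<Psi> where "\<Psi> = (\<lambda>w q. if q \<in> ?I then 1 / (r * \<Phi> w q) else \<Phi> w q)"
  have \<Psi>: "haar_preserving ?I \<Psi>"
    unfolding \<Psi>_def
    by (rule haar_preserving_comp[OF \<Phi>(1) haar_preserving_inversion[OF finite_trap_index order.refl \<open>r > 0\<close>]])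
  let ?J = "joint_integrand n m a0 a b r"
  have Gpos: "\<Gamma> > 0" unfolding \<Gamma>_def using \<theta> by (intro prod_pos) (auto intro: Gamma_real_pos)
  have "ennreal (\<integral>\<omega>. exp (- r * Z_trap n m W \<omega>) \<partial>M) = (\<integral>\<^sup>+ \<omega>. ?g (\<lambda>q\<in>?I. W q \<omega>) \<partial>M)"
    using int by (subst nn_integral_eq_integral[symmetric]) (auto simp: Z)
  also have "\<dots> = (\<integral>\<^sup>+ w. (\<Prod>q\<in>?I. ennreal (w q powr (- ?\<theta> q) * exp (- 1 / w q) / Gamma (?\<theta> q))) * ?g w \<partial>haar_prod ?I)"
  proof (rule nn_integral_indep_inv_gamma[OF finite_trap_index _ assms(6,7) \<theta>])
    show "?I \<noteq> {}" using \<open>n \<ge> 1\<close> by (auto simp: trap_index_def intro!: exI[of _ 1])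
  qed auto
  also have "\<dots> = (\<integral>\<^sup>+ w. ennreal (r powr (\<Sum>k = 1..n. a k) / \<Gamma>) * ennreal (?J (\<Psi> w)) \<partial>haar_prod ?I)"
  proof (rule nn_integral_cong_AE, use AE_haar_prod_pos[OF finite_trap_index[of n m]] in \<open>rule AE_mp\<close>, intro AE_I2 impI)
    fix w :: "nat \<times> nat \<Rightarrow> real" assume w: "\<forall>q\<in>?I. w q > 0"
    have nn: "w q powr (- ?\<theta> q) * exp (- 1 / w q) / Gamma (?\<theta> q) \<ge> 0" if "q \<in> ?I" for q
      using Gamma_real_pos[OF \<theta>[OF that]] by simp
    have "(\<Prod>q\<in>?I. ennreal (w q powr (- ?\<theta> q) * exp (- 1 / w q) / Gamma (?\<theta> q))) * ?g w
        = ennreal ((\<Prod>q\<in>?I. w q powr (- ?\<theta> q) * exp (- 1 / w q) / Gamma (?\<theta> q)) * exp (- r * ?Z w))"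
      using nn by (subst prod_ennreal) (auto simp: ennreal_mult prod_nonneg)
    also have "(\<Prod>q\<in>?I. w q powr (- ?\<theta> q) * exp (- 1 / w q) / Gamma (?\<theta> q)) * exp (- r * ?Z w)
        = ((\<Prod>q\<in>?I. w q powr (- ?\<theta> q) * exp (- 1 / w q)) * exp (- r * ?Z w)) / \<Gamma>"
      unfolding \<Gamma>_def by (simp only: prod_dividef times_divide_eq_left)
    also have "(\<Prod>q\<in>?I. w q powr (- ?\<theta> q) * exp (- 1 / w q)) * exp (- r * ?Z w)
        = r powr (\<Sum>k = 1..n. a k) * ?J (\<Psi> w)"
      by (rule joint_integrand_rsk_image[OF \<open>n \<ge> 1\<close> \<open>r > 0\<close> _ \<Phi>(2)[OF w], symmetric])
         (use w in \<open>auto simp: \<Psi>_def\<close>)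
    also have "r powr (\<Sum>k = 1..n. a k) * ?J (\<Psi> w) / \<Gamma> = r powr (\<Sum>k = 1..n. a k) / \<Gamma> * ?J (\<Psi> w)"
      by simp
    also have "ennreal \<dots> = ennreal (r powr (\<Sum>k = 1..n. a k) / \<Gamma>) * ennreal (?J (\<Psi> w))"
      using Gpos by (intro ennreal_mult')  auto
    finally show "(\<Prod>q\<in>?I. ennreal (w q powr (- ?\<theta> q) * exp (- 1 / w q) / Gamma (?\<theta> q))) * ?g w
        = ennreal (r powr (\<Sum>k = 1..n. a k) / \<Gamma>) * ennreal (?J (\<Psi> w))" .
  qed
  also have "\<dots> = ennreal (r powr (\<Sum>k = 1..n. a k) / \<Gamma>) * (\<integral>\<^sup>+ w. ennreal (?J (\<Psi> w)) \<partial>haar_prod ?I)"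
  proof (rule nn_integral_cmult)
    have "\<Psi> \<in> measurable (haar_prod ?I) (haar_prod ?I)" using \<Psi> by (simp add: haar_preserving_def)
    then show "(\<lambda>w. ennreal (?J (\<Psi> w))) \<in> borel_measurable (haar_prod ?I)"
      by (rule measurable_compose[OF _ measurable_compose[OF joint_integrand_measurable measurable_ennreal]])
  qed
  also have "(\<integral>\<^sup>+ w. ennreal (?J (\<Psi> w)) \<partial>haar_prod ?I) = (\<integral>\<^sup>+ s. ennreal (?J s) \<partial>haar_prod ?I)"
    by (rule \<Psi>[unfolded haar_preserving_def, THEN conjunct2, THEN bspec])
       (rule measurable_compose[OF joint_integrand_measurable measurable_ennreal])
  also have "\<dots> = (\<integral>\<^sup>+ x. T_fun n m a0 b r x * Psi_so n a x \<partial>haar_prod {1..n})"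
    by (rule nn_integral_joint_integrand[OF \<open>n \<ge> 1\<close>])
  finally show ?thesis unfolding \<Gamma>_def prod_Gamma_trap_param .
qed

end
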